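(* Let $E^s:\mathbf{Stone}\hookrightarrow\mathbf{ZHaus}$ and $E^a:\mathbf{kBoole}\hookrightarrow\mathbf{dzBoole}$ be the inclusion functors. Then $F(E^s(X))$ is an object of $\mathbf{kBoole}$ for every Stone space $X$, and $G(E^a(A,X_A))$ is a Stone space for every object $(A,X_A)$ of $\mathbf{kBoole}$. Thus the restrictions $F_s:\mathbf{Stone}\to\mathbf{kBoole}$ and $G_s:\mathbf{kBoole}\to\mathbf{Stone}$ of $F$ and $G$, respectively, are dual equivalences. Also, $\mathsf T=E^{-1}\circ F_s$ and $\mathsf S=G_s\circ E$; thus $\mathsf T$ and $\mathsf S$ are dual equivalences. Finally, $F\circ E^s=E^a\circ E\circ\mathsf T$ and $E^s\circ\mathsf S=G\circ E^a\circ E$ (so that the dual equivalences $F$ and $G$ are extensions of the dual equivalences $\mathsf T$ and $\mathsf S$, respectively).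
   Context: Boolean algebras with $0=1$ are allowed. $\mathbf{Boole}$ is the category of Boolean algebras and Boolean homomorphisms; $\mathbf{2}=\{0,1\}$ is the two-element Boolean algebra; $X_A=\mathbf{Boole}(A,\mathbf 2)$ is the set of Boolean homomorphisms $A\to\mathbf 2$. $\mathbf{ZHaus}$ is the category of zero-dimensional Hausdorff spaces (Hausdorff spaces having a base of clopen sets) and continuous maps; $\mathbf{Stone}$ is its full subcategory of compact spaces. $\mathsf{CO}(X)$ is the Boolean algebra of clopen subsets of $X$, and for continuous $f:X\to Y$, $\mathsf{CO}(f):\mathsf{CO}(Y)\to\mathsf{CO}(X)$ is $U\mapsto f^{-1}(U)$. For a Boolean algebra $A$ and $a\in A$, put $s_A(a)=\{x\in X_A\mid x(a)=1\}$. The contravariant functor $\mathsf S:\mathbf{Boole}\to\mathbf{Stone}$ sends $A$ to $X_A$ with the topology having $\{s_A(a)\mid a\in A\}$ as a base, and $\varphi:A\to B$ to $\mathsf S(\varphi):\mathsf S(B)\to\mathsf S(A)$, $y\mapsto y\circ\varphi$. The contravariant functor $\mathsf T:\mathbf{Stone}\to\mathbf{Boole}$ is the restriction of $\mathsf{CO}$ to $\mathbf{Stone}$. A Boolean z-algebra is a pair $(A,X)$, where $A$ is a Boolean algebra and $X\subseteq X_A$, such that for each $a\in A\setminus\{0\}$ there is $x\in X$ with $x(a)=1$. A Boolean dz-algebra is a Boolean z-algebra $(A,X)$ such that $\{X\cap s_A(a)\mid a\in A\}$ is the set of all clopen subsets of $X$, where $X$ carries the subspace topology from $\mathsf S(A)$.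 $\mathbf{dzBoole}$ is the category whose objects are all Boolean dz-algebras and whose morphisms $(A,X)\to(A',X')$ are all pairs $(\varphi,f)$ with $\varphi:A\to A'$ a Boolean homomorphism and $f:X'\to X$ a function such that $x'\circ\varphi=f(x')$ for every $x'\in X'$; composition is $(\varphi',f')\circ(\varphi,f)=(\varphi'\circ\varphi,f\circ f')$ and identities are $(id_A,id_X)$. $\mathbf{kBoole}$ is the full subcategory of $\mathbf{dzBoole}$ whose objects are all pairs $(A,X_A)$ with $A$ a Boolean algebra (compact dz-algebras). For a space $X$ and $x\in X$, $\hat x:\mathsf{CO}(X)\to\mathbf 2$ is given by $\hat x(U)=1\Leftrightarrow x\in U$; $\hat X=\{\hat x\mid x\in X\}$. The contravariant functor $F:\mathbf{ZHaus}\to\mathbf{dzBoole}$ is given by $F(X)=(\mathsf{CO}(X),\hat X)$ and, for $f:X\to Y$, $F(f)=(\mathsf{CO}(f),\hat f)$, where $\hat f:\hat X\to\hat Y$, $\hat f(\hat x)=\widehat{f(x)}$. The contravariant functor $G:\mathbf{dzBoole}\to\mathbf{ZHaus}$ is given by $G(A,X)=X$ (as a subspace of $\mathsf S(A)$) and $G(\varphi,f)=f$. The functors $F$ and $G$ are dual equivalences: $F\circ G$ and $G\circ F$ are naturally isomorphic to the identity functors. The functor $E:\mathbf{Boole}\to\mathbf{kBoole}$ is $E(A)=(A,X_A)$, $E(\varphi)=(\varphi,\mathsf S(\varphi))$; it is an isomorphism of categories with inverse $E^{-1}(A,X_A)=A$, $E^{-1}(\varphi,f)=\varphi$. *)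

theory Defs
  imports "HOL-Analysis.Analysis" "HOL-Library.Nat_Bijection"
begin

section \<open>A universe of sets\<close>

text \<open>
  All objects of a category have to live in one type, and that type has to be closed under
  the passage from a Boolean algebra to its homomorphisms into the two-element algebra and
  from a space to its clopen sets. As usual, the categories are therefore formed relative to
  a universe: the elements of a type in the following class are the ``sets'', an HOL set over
  this type is small if it is the extension of such an element, and the objects are the
  structures with a small carrier. The theory is
  generic in the universe; only closure under subsets and power sets is required, so that
  every Grothendieck universe, and every \<open>V\<^sub>\<lambda>\<close> with \<open>\<lambda>\<close> a limit ordinal, qualifies.
\<close>

class set_universe =
  fixes elts :: "'a \<Rightarrow> 'a set"
  assumes elts_inject: "elts x = elts y \<Longrightarrow> x = y"
    and elts_subset: "S \<subseteq> elts x \<Longrightarrow> \<exists>y. elts y = S"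
    and elts_power: "\<exists>p. elts p = {y. elts y \<subseteq> elts x}"

definition small :: "'u::set_universe set \<Rightarrow> bool" where
  "small S \<longleftrightarrow> S \<in> range elts"

text \<open>The element with extension \<open>S\<close>, for small \<open>S\<close>.\<close>

definition code :: "'u::set_universe set \<Rightarrow> 'u" where
  "code S = inv elts S"

text \<open>The axioms are consistent: the hereditarily finite sets form a universe.\<close>

instantiation nat :: set_universe
begin

definition elts_nat :: "nat \<Rightarrow> nat set" where
  "elts_nat = set_decode"

instance
proof
  fix x y :: nat
  show "elts x = elts y \<Longrightarrow> x = y"
    unfolding elts_nat_def by (metis set_decode_inverse)
next
  fix S and x :: nat
  assume "S \<subseteq> elts x"
  then have "finite S"
    unfolding elts_nat_def by (rule finite_subset) simp
  then show "\<exists>y. elts y = S"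
    unfolding elts_nat_def by (metis set_encode_inverse)
next
  fix x :: nat
  have "{y. set_decode y \<subseteq> set_decode x} \<subseteq> set_encode ` Pow (set_decode x)"
  proof
    fix y assume "y \<in> {y. set_decode y \<subseteq> set_decode x}"
    then show "y \<in> set_encode ` Pow (set_decode x)"
      by (intro image_eqI[of _ _ "set_decode y"]) auto
  qed
  then have "finite {y. set_decode y \<subseteq> set_decode x}"
    by (rule finite_subset) simp
  then show "\<exists>p. elts p = {y. elts y \<subseteq> elts x}"
    unfolding elts_nat_def by (metis set_encode_inverse)
qed

end


section \<open>Categories, functors, dual equivalences\<close>

record ('o, 'a) category =
  Ob :: "'o set"
  Ar :: "'a set"
  Dom :: "'a \<Rightarrow> 'o"
  Cod :: "'a \<Rightarrow> 'o"
  Idt :: "'o \<Rightarrow> 'a"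
  Cmp :: "'a \<Rightarrow> 'a \<Rightarrow> 'a"

definition is_category :: "('o, 'a) category \<Rightarrow> bool" where
  "is_category C \<longleftrightarrow>
     (\<forall>f\<in>Ar C. Dom C f \<in> Ob C \<and> Cod C f \<in> Ob C) \<and>
     (\<forall>X\<in>Ob C. Idt C X \<in> Ar C \<and> Dom C (Idt C X) = X \<and> Cod C (Idt C X) = X) \<and>
     (\<forall>f\<in>Ar C. \<forall>g\<in>Ar C. Cod C f = Dom C g \<longrightarrow>
        Cmp C g f \<in> Ar C \<and> Dom C (Cmp C g f) = Dom C f \<and> Cod C (Cmp C g f) = Cod C g) \<and>
     (\<forall>f\<in>Ar C. Cmp C f (Idt C (Dom C f)) = f \<and> Cmp C (Idt C (Cod C f)) f = f) \<and>
     (\<forall>f\<in>Ar C. \<forall>g\<in>Ar C. \<forall>h\<in>Ar C. Cod C f = Dom C g \<longrightarrow> Cod C g = Dom C h \<longrightarrow>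
        Cmp C h (Cmp C g f) = Cmp C (Cmp C h g) f)"

definition op_category :: "('o, 'a) category \<Rightarrow> ('o, 'a) category" where
  "op_category C = C\<lparr>Dom := Cod C, Cod := Dom C, Cmp := \<lambda>g f. Cmp C f g\<rparr>"

text \<open>The full subcategory with object set \<open>S\<close>, a subset of \<open>Ob C\<close>.\<close>

definition full_subcategory :: "('o, 'a) category \<Rightarrow> 'o set \<Rightarrow> ('o, 'a) category" where
  "full_subcategory C S = C\<lparr>Ob := S, Ar := {f \<in> Ar C. Dom C f \<in> S \<and> Cod C f \<in> S}\<rparr>"

definition isomorphism :: "('o, 'a) category \<Rightarrow> 'a \<Rightarrow> bool" where
  "isomorphism C f \<longleftrightarrow> f \<in> Ar C \<and>
     (\<exists>g\<in>Ar C. Dom C g = Cod C f \<and> Cod C g = Dom C f \<and>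
        Cmp C g f = Idt C (Dom C f) \<and> Cmp C f g = Idt C (Cod C f))"

text \<open>
  Functor data. The two maps are kept extensional (see \<open>mk_functor\<close>), so that equality
  of functors is equality in HOL. The variance is not part of the data.
\<close>

record ('o, 'a, 'p, 'b) functor_data =
  Src :: "('o, 'a) category"
  Tgt :: "('p, 'b) category"
  fob :: "'o \<Rightarrow> 'p"
  far :: "'a \<Rightarrow> 'b"

definition mk_functor ::
    "('o, 'a) category \<Rightarrow> ('p, 'b) category \<Rightarrow> ('o \<Rightarrow> 'p) \<Rightarrow> ('a \<Rightarrow> 'b)
      \<Rightarrow> ('o, 'a, 'p, 'b) functor_data" where
  "mk_functor C D o' a' =
     \<lparr>Src = C, Tgt = D, fob = restrict o' (Ob C), far = restrict a' (Ar C)\<rparr>"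

definition id_functor :: "('o, 'a) category \<Rightarrow> ('o, 'a, 'o, 'a) functor_data" where
  "id_functor C = mk_functor C C (\<lambda>X. X) (\<lambda>f. f)"

definition inclusion_functor ::
    "('o, 'a) category \<Rightarrow> ('o, 'a) category \<Rightarrow> ('o, 'a, 'o, 'a) functor_data" where
  "inclusion_functor C D = mk_functor C D (\<lambda>X. X) (\<lambda>f. f)"

definition comp_functor ::
    "('p, 'b, 'q, 'c) functor_data \<Rightarrow> ('o, 'a, 'p, 'b) functor_data \<Rightarrow> ('o, 'a, 'q, 'c) functor_data"
    (infixr "\<circ>\<^sub>F" 55) where
  "G \<circ>\<^sub>F F = mk_functor (Src F) (Tgt G) (fob G \<circ> fob F) (far G \<circ> far F)"

text \<open>The restriction of a functor to subcategories \<open>C\<close> of its source and \<open>D\<close> of its target.\<close>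

definition restrict_functor ::
    "('o, 'a, 'p, 'b) functor_data \<Rightarrow> ('o, 'a) category \<Rightarrow> ('p, 'b) category
      \<Rightarrow> ('o, 'a, 'p, 'b) functor_data" where
  "restrict_functor F C D = mk_functor C D (fob F) (far F)"

definition covariant :: "('o, 'a, 'p, 'b) functor_data \<Rightarrow> bool" where
  "covariant F \<longleftrightarrow> (let C = Src F; D = Tgt F in
     is_category C \<and> is_category D \<and>
     fob F \<in> Ob C \<rightarrow>\<^sub>E Ob D \<and> far F \<in> Ar C \<rightarrow>\<^sub>E Ar D \<and>
     (\<forall>f\<in>Ar C. Dom D (far F f) = fob F (Dom C f) \<and> Cod D (far F f) = fob F (Cod C f)) \<and>
     (\<forall>X\<in>Ob C. far F (Idt C X) = Idt D (fob F X)) \<and>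
     (\<forall>f\<in>Ar C. \<forall>g\<in>Ar C. Cod C f = Dom C g \<longrightarrow>
        far F (Cmp C g f) = Cmp D (far F g) (far F f)))"

definition contravariant :: "('o, 'a, 'p, 'b) functor_data \<Rightarrow> bool" where
  "contravariant F \<longleftrightarrow> is_category (Tgt F) \<and> covariant (F\<lparr>Tgt := op_category (Tgt F)\<rparr>)"

definition naturally_isomorphic ::
    "('o, 'a, 'p, 'b) functor_data \<Rightarrow> ('o, 'a, 'p, 'b) functor_data \<Rightarrow> bool" where
  "naturally_isomorphic F G \<longleftrightarrow>
     covariant F \<and> covariant G \<and> Src F = Src G \<and> Tgt F = Tgt G \<and>
     (let C = Src F; D = Tgt F in
      \<exists>\<eta>. (\<forall>X\<in>Ob C. isomorphism D (\<eta> X) \<and> Dom D (\<eta> X) = fob F X \<and> Cod D (\<eta> X) = fob G X) \<and>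
          (\<forall>f\<in>Ar C. Cmp D (\<eta> (Cod C f)) (far F f) = Cmp D (far G f) (\<eta> (Dom C f))))"

definition dual_equivalences ::
    "('o, 'a, 'p, 'b) functor_data \<Rightarrow> ('p, 'b, 'o, 'a) functor_data \<Rightarrow> bool" where
  "dual_equivalences F G \<longleftrightarrow>
     contravariant F \<and> contravariant G \<and> Src G = Tgt F \<and> Tgt G = Src F \<and>
     naturally_isomorphic (G \<circ>\<^sub>F F) (id_functor (Src F)) \<and>
     naturally_isomorphic (F \<circ>\<^sub>F G) (id_functor (Src G))"

text \<open>
  In the concrete categories an arrow is an underlying function (or pair of functions)
  together with its source and target.
\<close>

datatype ('o, 'm) arrow = Arrow (src: 'o) (tgt: 'o) (mor: 'm)

text \<open>
  Here \<open>H X Y\<close> is the set of underlying functions of the arrows from \<open>X\<close> to \<open>Y\<close>; the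
  composition \<open>c X Z g f\<close> is given the outer source and target because the underlying
  functions have to be restricted to carriers.
\<close>

definition arrow_category ::
    "'o set \<Rightarrow> ('o \<Rightarrow> 'o \<Rightarrow> 'm set) \<Rightarrow> ('o \<Rightarrow> 'm) \<Rightarrow> ('o \<Rightarrow> 'o \<Rightarrow> 'm \<Rightarrow> 'm \<Rightarrow> 'm)
      \<Rightarrow> ('o, ('o, 'm) arrow) category" where
  "arrow_category Obs H i c =
     \<lparr>Ob = Obs,
      Ar = {Arrow X Y f | X Y f. X \<in> Obs \<and> Y \<in> Obs \<and> f \<in> H X Y},
      Dom = src,
      Cod = tgt,
      Idt = (\<lambda>X. Arrow X X (i X)),
      Cmp = (\<lambda>g f. Arrow (src f) (tgt g) (c (src f) (tgt g) (mor g) (mor f)))\<rparr>"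


section \<open>Boolean algebras\<close>

record 'a boolalg =
  carrier :: "'a set"
  meet :: "'a \<Rightarrow> 'a \<Rightarrow> 'a"
  join :: "'a \<Rightarrow> 'a \<Rightarrow> 'a"
  compl :: "'a \<Rightarrow> 'a"
  zero :: 'a
  one :: 'a

text \<open>
  The axioms of the library locale \<open>abstract_boolean_algebra\<close>, relativised to a carrier;
  \<open>zero A = one A\<close> is allowed.
\<close>

locale boolean_algebra_on =
  fixes A :: "'a boolalg"
  assumes meet_closed: "\<lbrakk>a \<in> carrier A; b \<in> carrier A\<rbrakk> \<Longrightarrow> meet A a b \<in> carrier A"
    and join_closed: "\<lbrakk>a \<in> carrier A; b \<in> carrier A\<rbrakk> \<Longrightarrow> join A a b \<in> carrier A"
    and compl_closed: "a \<in> carrier A \<Longrightarrow> compl A a \<in> carrier A"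
    and zero_closed: "zero A \<in> carrier A"
    and one_closed: "one A \<in> carrier A"
    and meet_assoc: "\<lbrakk>a \<in> carrier A; b \<in> carrier A; c \<in> carrier A\<rbrakk>
          \<Longrightarrow> meet A (meet A a b) c = meet A a (meet A b c)"
    and join_assoc: "\<lbrakk>a \<in> carrier A; b \<in> carrier A; c \<in> carrier A\<rbrakk>
          \<Longrightarrow> join A (join A a b) c = join A a (join A b c)"
    and meet_commute: "\<lbrakk>a \<in> carrier A; b \<in> carrier A\<rbrakk> \<Longrightarrow> meet A a b = meet A b a"
    and join_commute: "\<lbrakk>a \<in> carrier A; b \<in> carrier A\<rbrakk> \<Longrightarrow> join A a b = join A b a"
    and meet_join_distrib: "\<lbrakk>a \<in> carrier A; b \<in> carrier A; c \<in> carrier A\<rbrakk>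
          \<Longrightarrow> meet A a (join A b c) = join A (meet A a b) (meet A a c)"
    and join_meet_distrib: "\<lbrakk>a \<in> carrier A; b \<in> carrier A; c \<in> carrier A\<rbrakk>
          \<Longrightarrow> join A a (meet A b c) = meet A (join A a b) (join A a c)"
    and meet_one: "a \<in> carrier A \<Longrightarrow> meet A a (one A) = a"
    and join_zero: "a \<in> carrier A \<Longrightarrow> join A a (zero A) = a"
    and meet_compl: "a \<in> carrier A \<Longrightarrow> meet A a (compl A a) = zero A"
    and join_compl: "a \<in> carrier A \<Longrightarrow> join A a (compl A a) = one A"

definition boolean_homs :: "'a boolalg \<Rightarrow> 'b boolalg \<Rightarrow> ('a \<Rightarrow> 'b) set" where
  "boolean_homs A B = {\<phi> \<in> carrier A \<rightarrow>\<^sub>E carrier B.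
     (\<forall>a\<in>carrier A. \<forall>b\<in>carrier A. \<phi> (meet A a b) = meet B (\<phi> a) (\<phi> b)) \<and>
     (\<forall>a\<in>carrier A. \<forall>b\<in>carrier A. \<phi> (join A a b) = join B (\<phi> a) (\<phi> b)) \<and>
     (\<forall>a\<in>carrier A. \<phi> (compl A a) = compl B (\<phi> a)) \<and>
     \<phi> (zero A) = zero B \<and> \<phi> (one A) = one B}"

type_synonym 'u boolarr = "('u boolalg, 'u \<Rightarrow> 'u) arrow"

definition Boole :: "('u::set_universe boolalg, 'u boolarr) category" where
  "Boole = arrow_category
     {A. boolean_algebra_on A \<and> small (carrier A)}
     boolean_homs
     (\<lambda>A. \<lambda>a\<in>carrier A. a)
     (\<lambda>A C \<psi> \<phi>. compose (carrier A) \<psi> \<phi>)"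

definition two :: "bool boolalg" where
  "two = \<lparr>carrier = UNIV, meet = (\<and>), join = (\<or>), compl = Not, zero = False, one = True\<rparr>"

text \<open>The set written \<open>X\<^sub>A\<close>, and its basic clopen subsets.\<close>

definition pts :: "'a boolalg \<Rightarrow> ('a \<Rightarrow> bool) set" where
  "pts A = boolean_homs A two"

definition basic :: "'a boolalg \<Rightarrow> 'a \<Rightarrow> ('a \<Rightarrow> bool) set" where
  "basic A a = {x \<in> pts A. x a = True}"

definition stone_topology :: "'a boolalg \<Rightarrow> ('a \<Rightarrow> bool) topology" where
  "stone_topology A = topology (arbitrary union_of (\<lambda>U. \<exists>a\<in>carrier A. U = basic A a))"

text \<open>The map \<open>X\<^sub>B \<rightarrow> X\<^sub>A\<close>, \<open>y \<mapsto> y \<circ> \<phi>\<close>, for \<open>\<phi> : A \<rightarrow> B\<close>.\<close>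

definition precomp ::
    "'a boolalg \<Rightarrow> 'b boolalg \<Rightarrow> ('a \<Rightarrow> 'b) \<Rightarrow> ('b \<Rightarrow> bool) \<Rightarrow> ('a \<Rightarrow> bool)" where
  "precomp A B \<phi> = (\<lambda>y\<in>pts B. compose (carrier A) y \<phi>)"


section \<open>Zero-dimensional Hausdorff spaces\<close>

definition zero_dimensional :: "'a topology \<Rightarrow> bool" where
  "zero_dimensional X \<longleftrightarrow> openin X = arbitrary union_of (\<lambda>U. openin X U \<and> closedin X U)"

type_synonym 'u toparr = "('u topology, 'u \<Rightarrow> 'u) arrow"

definition ZHaus :: "('u::set_universe topology, 'u toparr) category" where
  "ZHaus = arrow_category
     {X. Hausdorff_space X \<and> zero_dimensional X \<and> small (topspace X)}
     (\<lambda>X Y. {f \<in> extensional (topspace X). continuous_map X Y f})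
     (\<lambda>X. \<lambda>x\<in>topspace X. x)
     (\<lambda>X Z g f. compose (topspace X) g f)"

definition Stone :: "('u::set_universe topology, 'u toparr) category" where
  "Stone = full_subcategory ZHaus {X \<in> Ob ZHaus. compact_space X}"

text \<open>The algebra of clopen sets, each clopen set being replaced by its code.\<close>

definition CO :: "'u::set_universe topology \<Rightarrow> 'u boolalg" where
  "CO X =
     \<lparr>carrier = code ` {U. openin X U \<and> closedin X U},
      meet = (\<lambda>u v. code (elts u \<inter> elts v)),
      join = (\<lambda>u v. code (elts u \<union> elts v)),
      compl = (\<lambda>u. code (topspace X - elts u)),
      zero = code {},
      one = code (topspace X)\<rparr>"

definition CO_map ::
    "'u::set_universe topology \<Rightarrow> 'u topology \<Rightarrow> ('u \<Rightarrow> 'u) \<Rightarrow> ('u \<Rightarrow> 'u)" where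
  "CO_map X Y f = (\<lambda>u\<in>carrier (CO Y). code {x \<in> topspace X. f x \<in> elts u})"

definition CO_functor ::
    "('u::set_universe topology, 'u toparr, 'u boolalg, 'u boolarr) functor_data" where
  "CO_functor = mk_functor ZHaus Boole CO
     (\<lambda>h. Arrow (CO (tgt h)) (CO (src h)) (CO_map (src h) (tgt h) (mor h)))"

definition T_functor ::
    "('u::set_universe topology, 'u toparr, 'u boolalg, 'u boolarr) functor_data" where
  "T_functor = restrict_functor CO_functor Stone Boole"

text \<open>
  A homomorphism \<open>x : A \<rightarrow> 2\<close> is coded by the element of the universe with extension
  \<open>x\<^sup>-\<^sup>1(1)\<close>; \<open>decode A\<close> recovers the homomorphism, and \<open>encode A T\<close> is the space \<open>T\<close>
  of such homomorphisms with every point replaced by its code.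
\<close>

definition code_point :: "'u::set_universe boolalg \<Rightarrow> ('u \<Rightarrow> bool) \<Rightarrow> 'u" where
  "code_point A x = code {a \<in> carrier A. x a}"

definition decode :: "'u::set_universe boolalg \<Rightarrow> 'u \<Rightarrow> ('u \<Rightarrow> bool)" where
  "decode A p = (\<lambda>a\<in>carrier A. a \<in> elts p)"

definition encode :: "'u::set_universe boolalg \<Rightarrow> ('u \<Rightarrow> bool) topology \<Rightarrow> 'u topology" where
  "encode A T = pullback_topology (code_point A ` topspace T) (decode A) T"

definition S_ob :: "'u::set_universe boolalg \<Rightarrow> 'u topology" where
  "S_ob A = encode A (stone_topology A)"

definition S_functor ::
    "('u::set_universe boolalg, 'u boolarr, 'u topology, 'u toparr) functor_data" where
  "S_functor = mk_functor Boole Stone S_ob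
     (\<lambda>h. Arrow (S_ob (tgt h)) (S_ob (src h))
        (\<lambda>p\<in>topspace (S_ob (tgt h)).
           code_point (src h) (precomp (src h) (tgt h) (mor h) (decode (tgt h) p))))"


section \<open>Boolean dz-algebras\<close>

type_synonym 'u zalg = "'u boolalg \<times> ('u \<Rightarrow> bool) set"

type_synonym 'u zmor = "('u \<Rightarrow> 'u) \<times> (('u \<Rightarrow> bool) \<Rightarrow> ('u \<Rightarrow> bool))"

type_synonym 'u zarr = "('u zalg, 'u zmor) arrow"

definition z_algebra :: "'u zalg \<Rightarrow> bool" where
  "z_algebra P \<longleftrightarrow> (case P of (A, X) \<Rightarrow>
     boolean_algebra_on A \<and> X \<subseteq> pts A \<and>
     (\<forall>a\<in>carrier A - {zero A}. \<exists>x\<in>X. x a = True))"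

definition dz_algebra :: "'u zalg \<Rightarrow> bool" where
  "dz_algebra P \<longleftrightarrow> z_algebra P \<and> (case P of (A, X) \<Rightarrow>
     {X \<inter> basic A a | a. a \<in> carrier A} =
     {U. openin (subtopology (stone_topology A) X) U \<and>
         closedin (subtopology (stone_topology A) X) U})"

definition dz_homs :: "'u zalg \<Rightarrow> 'u zalg \<Rightarrow> 'u zmor set" where
  "dz_homs P P' = (case P of (A, X) \<Rightarrow> case P' of (A', X') \<Rightarrow>
     {(\<phi>, f). \<phi> \<in> boolean_homs A A' \<and> f \<in> X' \<rightarrow>\<^sub>E X \<and>
        (\<forall>x'\<in>X'. compose (carrier A) x' \<phi> = f x')})"

definition dzBoole :: "('u::set_universe zalg, 'u zarr) category" where
  "dzBoole = arrow_category
     {P. dz_algebra P \<and> small (carrier (fst P))}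
     dz_homs
     (\<lambda>P. (\<lambda>a\<in>carrier (fst P). a, \<lambda>x\<in>snd P. x))
     (\<lambda>P P'' h' h. (compose (carrier (fst P)) (fst h') (fst h), compose (snd P'') (snd h) (snd h')))"

definition kBoole :: "('u::set_universe zalg, 'u zarr) category" where
  "kBoole = full_subcategory dzBoole {(A, pts A) | A. A \<in> Ob Boole}"

definition E_functor ::
    "('u::set_universe boolalg, 'u boolarr, 'u zalg, 'u zarr) functor_data" where
  "E_functor = mk_functor Boole kBoole (\<lambda>A. (A, pts A))
     (\<lambda>h. Arrow (src h, pts (src h)) (tgt h, pts (tgt h))
            (mor h, precomp (src h) (tgt h) (mor h)))"

definition Einv_functor ::
    "('u::set_universe zalg, 'u zarr, 'u boolalg, 'u boolarr) functor_data" where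
  "Einv_functor = mk_functor kBoole Boole fst
     (\<lambda>h. Arrow (fst (src h)) (fst (tgt h)) (fst (mor h)))"


section \<open>The functors between spaces and dz-algebras\<close>

definition hat :: "'u::set_universe topology \<Rightarrow> 'u \<Rightarrow> ('u \<Rightarrow> bool)" where
  "hat X x = (\<lambda>u\<in>carrier (CO X). x \<in> elts u)"

definition hats :: "'u::set_universe topology \<Rightarrow> ('u \<Rightarrow> bool) set" where
  "hats X = hat X ` topspace X"

text \<open>
  The map sending \<open>hat X x\<close> to \<open>hat Y (f x)\<close>; \<open>hat X\<close> is injective on the points of a
  zero-dimensional Hausdorff space.
\<close>

definition hat_map ::
    "'u::set_universe topology \<Rightarrow> 'u topology \<Rightarrow> ('u \<Rightarrow> 'u) \<Rightarrow> ('u \<Rightarrow> bool) \<Rightarrow> ('u \<Rightarrow> bool)" where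
  "hat_map X Y f = (\<lambda>z\<in>hats X. hat Y (f (inv_into (topspace X) (hat X) z)))"

definition F_ob :: "'u::set_universe topology \<Rightarrow> 'u zalg" where
  "F_ob X = (CO X, hats X)"

definition F_functor ::
    "('u::set_universe topology, 'u toparr, 'u zalg, 'u zarr) functor_data" where
  "F_functor = mk_functor ZHaus dzBoole F_ob
     (\<lambda>h. Arrow (F_ob (tgt h)) (F_ob (src h))
            (CO_map (src h) (tgt h) (mor h), hat_map (src h) (tgt h) (mor h)))"

definition G_ob :: "'u::set_universe zalg \<Rightarrow> 'u topology" where
  "G_ob P = (case P of (A, X) \<Rightarrow> encode A (subtopology (stone_topology A) X))"

definition G_functor ::
    "('u::set_universe zalg, 'u zarr, 'u topology, 'u toparr) functor_data" where
  "G_functor = mk_functor dzBoole ZHaus G_ob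
     (\<lambda>h. Arrow (G_ob (tgt h)) (G_ob (src h))
        (\<lambda>p\<in>topspace (G_ob (tgt h)).
           code_point (fst (src h)) (snd (mor h) (decode (fst (tgt h)) p))))"

definition Es_functor ::
    "('u::set_universe topology, 'u toparr, 'u topology, 'u toparr) functor_data" where
  "Es_functor = inclusion_functor Stone ZHaus"

definition Ea_functor ::
    "('u::set_universe zalg, 'u zarr, 'u zalg, 'u zarr) functor_data" where
  "Ea_functor = inclusion_functor kBoole dzBoole"

definition Fs_functor ::
    "('u::set_universe topology, 'u toparr, 'u zalg, 'u zarr) functor_data" where
  "Fs_functor = restrict_functor F_functor Stone kBoole"

definition Gs_functor ::
    "('u::set_universe zalg, 'u zarr, 'u topology, 'u toparr) functor_data" where
  "Gs_functor = restrict_functor G_functor kBoole Stone"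

end

theory Submission
  imports Defs
begin

text \<open>
  The functors between Boolean algebras and Stone spaces are dual equivalences by the prime filter
  theorem: it makes the Stone space of \<open>A\<close> compact with exactly the basic sets as its clopen
  sets, so that \<open>A\<close> is its algebra of clopen sets, and conversely, by compactness, every
  homomorphism from the clopen algebra of a Stone space to the two-element algebra is evaluation at
  a point. Hence \<open>hats X = pts (CO X)\<close> for a Stone space \<open>X\<close>, which turns the restrictions
  of \<open>F\<close> and \<open>G\<close> into \<open>E \<circ> T\<close> and \<open>S \<circ> E\<^sup>-\<^sup>1\<close>. As \<open>E\<close> is an isomorphism of
  categories, these are dual equivalences as well, and the remaining equations are formal.
\<close>

section \<open>Categories and functors\<close>

text \<open>The equations between functors are equations in HOL, so agreement up to isomorphism is
  not enough: the restrictions of F and G have to coincide with composites of T, S and E on the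
  nose, underlying functions included. Two devices make this feasible. The maps of a functor are
  extensional, so it suffices to compare them on the source category. And a point of a coded Stone
  space is the element of the universe whose extension is the ultrafilter of a homomorphism, so
  coded points are compared through \<open>elts_inject\<close>: precomposition becomes inverse
  image, and the basic clopen set of \<open>a\<close> becomes the set of all \<open>p\<close> with
  \<open>a\<close> in \<open>elts p\<close>. Both natural isomorphisms are built as maps out of the
  identity functor: a point goes to the ultrafilter of its clopen neighbourhoods, an element of an
  algebra to its basic clopen set. The definition of dual equivalence asks for the other direction,
  which is why natural isomorphisms have to be inverted.\<close>

lemma is_category_arrow_category:
  assumes id: "\<And>X. X \<in> Obs \<Longrightarrow> i X \<in> H X X"
    and comp: "\<And>X Y Z f g. \<lbrakk>X \<in> Obs; Y \<in> Obs; Z \<in> Obs; f \<in> H X Y; g \<in> H Y Z\<rbrakk> \<Longrightarrow> c X Z g f \<in> H X Z"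
    and id_right: "\<And>X Y f. \<lbrakk>X \<in> Obs; Y \<in> Obs; f \<in> H X Y\<rbrakk> \<Longrightarrow> c X Y f (i X) = f"
    and id_left: "\<And>X Y f. \<lbrakk>X \<in> Obs; Y \<in> Obs; f \<in> H X Y\<rbrakk> \<Longrightarrow> c X Y (i Y) f = f"
    and assoc: "\<And>W X Y Z f g h. \<lbrakk>W \<in> Obs; X \<in> Obs; Y \<in> Obs; Z \<in> Obs; f \<in> H W X; g \<in> H X Y; h \<in> H Y Z\<rbrakk>
      \<Longrightarrow> c W Z h (c W Y g f) = c W Z (c X Z h g) f"
  shows "is_category (arrow_category Obs H i c)"
  unfolding is_category_def arrow_category_def
  by (auto simp: id comp id_left id_right assoc)

lemma is_category_full_subcategory:
  assumes "is_category C" "S \<subseteq> Ob C"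
  shows "is_category (full_subcategory C S)"
  using assms unfolding is_category_def full_subcategory_def by (simp add: subset_iff)

lemma is_category_op:
  assumes "is_category C"
  shows "is_category (op_category C)"
  using assms unfolding is_category_def op_category_def by simp

lemma mk_functor_sel [simp]:
  "Src (mk_functor C D p q) = C" "Tgt (mk_functor C D p q) = D"
  "X \<in> Ob C \<Longrightarrow> fob (mk_functor C D p q) X = p X"
  "f \<in> Ar C \<Longrightarrow> far (mk_functor C D p q) f = q f"
  by (simp_all add: mk_functor_def)

text \<open>Both maps of \<open>mk_functor\<close> are restricted to the source category, so
  pointwise agreement there is already equality of functors. The functor equations below are reduced
  to this rule.\<close>

lemma mk_functor_cong:
  assumes "C = C'" "D = D'" "\<And>X. X \<in> Ob C' \<Longrightarrow> p X = p' X" "\<And>f. f \<in> Ar C' \<Longrightarrow> q f = q' f"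
  shows "mk_functor C D p q = mk_functor C' D' p' q'"
  using assms by (simp add: mk_functor_def cong: restrict_cong)

lemma covariant_mk_functorI:
  assumes "is_category C" "is_category D"
    and "\<And>X. X \<in> Ob C \<Longrightarrow> p X \<in> Ob D"
    and "\<And>f. f \<in> Ar C \<Longrightarrow> q f \<in> Ar D \<and> Dom D (q f) = p (Dom C f) \<and> Cod D (q f) = p (Cod C f)"
    and "\<And>X. X \<in> Ob C \<Longrightarrow> q (Idt C X) = Idt D (p X)"
    and "\<And>f g. \<lbrakk>f \<in> Ar C; g \<in> Ar C; Cod C f = Dom C g\<rbrakk> \<Longrightarrow> q (Cmp C g f) = Cmp D (q g) (q f)"
  shows "covariant (mk_functor C D p q)"
  using assms unfolding covariant_def Let_def is_category_def mk_functor_def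
  by (simp add: restrict_PiE_iff)

lemma contravariant_mk_functorI:
  assumes "is_category C" "is_category D"
    and "\<And>X. X \<in> Ob C \<Longrightarrow> p X \<in> Ob D"
    and "\<And>f. f \<in> Ar C \<Longrightarrow> q f \<in> Ar D \<and> Dom D (q f) = p (Cod C f) \<and> Cod D (q f) = p (Dom C f)"
    and "\<And>X. X \<in> Ob C \<Longrightarrow> q (Idt C X) = Idt D (p X)"
    and "\<And>f g. \<lbrakk>f \<in> Ar C; g \<in> Ar C; Cod C f = Dom C g\<rbrakk> \<Longrightarrow> q (Cmp C g f) = Cmp D (q f) (q g)"
  shows "contravariant (mk_functor C D p q)"
proof -
  have eq: "(mk_functor C D p q)\<lparr>Tgt := op_category D\<rparr> = mk_functor C (op_category D) p q"
    by (simp add: mk_functor_def)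
  have "covariant (mk_functor C (op_category D) p q)"
    by (rule covariant_mk_functorI) (use assms is_category_op in \<open>auto simp: op_category_def\<close>)
  with assms(2) show ?thesis
    unfolding contravariant_def by (simp add: eq)
qed

lemma covariantD:
  assumes "covariant F"
  shows "is_category (Src F)" "is_category (Tgt F)"
    and "X \<in> Ob (Src F) \<Longrightarrow> fob F X \<in> Ob (Tgt F)"
    and "f \<in> Ar (Src F) \<Longrightarrow> far F f \<in> Ar (Tgt F)"
    and "f \<in> Ar (Src F) \<Longrightarrow> Dom (Tgt F) (far F f) = fob F (Dom (Src F) f)"
    and "f \<in> Ar (Src F) \<Longrightarrow> Cod (Tgt F) (far F f) = fob F (Cod (Src F) f)"
    and "X \<in> Ob (Src F) \<Longrightarrow> far F (Idt (Src F) X) = Idt (Tgt F) (fob F X)"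
    and "\<lbrakk>f \<in> Ar (Src F); g \<in> Ar (Src F); Cod (Src F) f = Dom (Src F) g\<rbrakk>
      \<Longrightarrow> far F (Cmp (Src F) g f) = Cmp (Tgt F) (far F g) (far F f)"
  using assms by (auto simp: covariant_def Let_def)

lemma contravariantD:
  assumes "contravariant F"
  shows "is_category (Src F)" "is_category (Tgt F)"
    and "X \<in> Ob (Src F) \<Longrightarrow> fob F X \<in> Ob (Tgt F)"
    and "f \<in> Ar (Src F) \<Longrightarrow> far F f \<in> Ar (Tgt F)"
    and "f \<in> Ar (Src F) \<Longrightarrow> Dom (Tgt F) (far F f) = fob F (Cod (Src F) f)"
    and "f \<in> Ar (Src F) \<Longrightarrow> Cod (Tgt F) (far F f) = fob F (Dom (Src F) f)"
    and "X \<in> Ob (Src F) \<Longrightarrow> far F (Idt (Src F) X) = Idt (Tgt F) (fob F X)"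
    and "\<lbrakk>f \<in> Ar (Src F); g \<in> Ar (Src F); Cod (Src F) f = Dom (Src F) g\<rbrakk>
      \<Longrightarrow> far F (Cmp (Src F) g f) = Cmp (Tgt F) (far F f) (far F g)"
  using assms by (auto simp: contravariant_def covariant_def Let_def op_category_def)

lemma is_categoryD:
  assumes "is_category C"
  shows "f \<in> Ar C \<Longrightarrow> Dom C f \<in> Ob C" "f \<in> Ar C \<Longrightarrow> Cod C f \<in> Ob C"
    and "X \<in> Ob C \<Longrightarrow> Idt C X \<in> Ar C" "X \<in> Ob C \<Longrightarrow> Dom C (Idt C X) = X" "X \<in> Ob C \<Longrightarrow> Cod C (Idt C X) = X"
    and "\<lbrakk>f \<in> Ar C; g \<in> Ar C; Cod C f = Dom C g\<rbrakk> \<Longrightarrow> Cmp C g f \<in> Ar C"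
    and "\<lbrakk>f \<in> Ar C; g \<in> Ar C; Cod C f = Dom C g\<rbrakk> \<Longrightarrow> Dom C (Cmp C g f) = Dom C f"
    and "\<lbrakk>f \<in> Ar C; g \<in> Ar C; Cod C f = Dom C g\<rbrakk> \<Longrightarrow> Cod C (Cmp C g f) = Cod C g"
    and "f \<in> Ar C \<Longrightarrow> Cmp C f (Idt C (Dom C f)) = f" "f \<in> Ar C \<Longrightarrow> Cmp C (Idt C (Cod C f)) f = f"
    and "\<lbrakk>f \<in> Ar C; g \<in> Ar C; h \<in> Ar C; Cod C f = Dom C g; Cod C g = Dom C h\<rbrakk>
      \<Longrightarrow> Cmp C h (Cmp C g f) = Cmp C (Cmp C h g) f"
  using assms unfolding is_category_def by auto

lemma covariant_id_functor: "is_category C \<Longrightarrow> covariant (id_functor C)"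
  unfolding id_functor_def by (rule covariant_mk_functorI) (auto simp: is_categoryD)

lemma comp_functor_sel [simp]:
  "Src (G \<circ>\<^sub>F F) = Src F" "Tgt (G \<circ>\<^sub>F F) = Tgt G"
  "X \<in> Ob (Src F) \<Longrightarrow> fob (G \<circ>\<^sub>F F) X = fob G (fob F X)"
  "f \<in> Ar (Src F) \<Longrightarrow> far (G \<circ>\<^sub>F F) f = far G (far F f)"
  by (simp_all add: comp_functor_def)

lemma covariant_comp_functor:
  assumes "covariant F" "covariant G" "Src G = Tgt F"
  shows "covariant (G \<circ>\<^sub>F F)"
  unfolding comp_functor_def
  by (rule covariant_mk_functorI)
    (use covariantD[OF assms(1)] covariantD[OF assms(2)] assms(3) in \<open>auto simp: is_categoryD\<close>)

lemma covariant_comp_contravariant: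
  assumes "contravariant F" "contravariant G" "Src G = Tgt F"
  shows "covariant (G \<circ>\<^sub>F F)"
  unfolding comp_functor_def
  by (rule covariant_mk_functorI)
    (use contravariantD[OF assms(1)] contravariantD[OF assms(2)] assms(3) in \<open>auto simp: is_categoryD\<close>)

lemma contravariant_comp_left:
  assumes "contravariant F" "covariant G" "Src G = Tgt F"
  shows "contravariant (G \<circ>\<^sub>F F)"
  unfolding comp_functor_def
  by (rule contravariant_mk_functorI)
    (use contravariantD[OF assms(1)] covariantD[OF assms(2)] assms(3) in \<open>auto simp: is_categoryD\<close>)

lemma contravariant_comp_right:
  assumes "covariant F" "contravariant G" "Src G = Tgt F"
  shows "contravariant (G \<circ>\<^sub>F F)"
  unfolding comp_functor_def
  by (rule contravariant_mk_functorI)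
    (use covariantD[OF assms(1)] contravariantD[OF assms(2)] assms(3) in \<open>auto simp: is_categoryD\<close>)

section \<open>Natural isomorphisms and transport of dual equivalences\<close>

lemma isomorphism_image:
  assumes "covariant F" "isomorphism (Src F) f"
  shows "isomorphism (Tgt F) (far F f)"
proof -
  note F = covariantD[OF assms(1)]
  obtain g where f: "f \<in> Ar (Src F)" and g: "g \<in> Ar (Src F)" "Dom (Src F) g = Cod (Src F) f"
    "Cod (Src F) g = Dom (Src F) f" "Cmp (Src F) g f = Idt (Src F) (Dom (Src F) f)"
    "Cmp (Src F) f g = Idt (Src F) (Cod (Src F) f)"
    using assms(2) unfolding isomorphism_def by blast
  have "Cmp (Tgt F) (far F g) (far F f) = Idt (Tgt F) (Dom (Tgt F) (far F f))"
    "Cmp (Tgt F) (far F f) (far F g) = Idt (Tgt F) (Cod (Tgt F) (far F f))"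
    using f g F(8)[of f g] F(8)[of g f] by (simp_all add: F is_categoryD)
  with f g show ?thesis
    unfolding isomorphism_def by (intro conjI bexI[of _ "far F g"]) (simp_all add: F)
qed

text \<open>The inverses of the components form a natural transformation because the naturality
  square can be conjugated by them. This lets the isomorphisms be constructed from the identity
  functor to the composite, which is the direction of the explicit unit maps.\<close>

lemma naturally_isomorphic_sym:
  assumes "naturally_isomorphic F G"
  shows "naturally_isomorphic G F"
proof -
  define C D where "C = Src F" and "D = Tgt F"
  from assms have F: "covariant F" and G: "covariant G" and CG: "Src G = C" and DG: "Tgt G = D"
    by (auto simp: naturally_isomorphic_def C_def D_def)
  from assms obtain \<eta> where
    iso: "\<And>X. X \<in> Ob C \<Longrightarrow> isomorphism D (\<eta> X) \<and> Dom D (\<eta> X) = fob F X \<and> Cod D (\<eta> X) = fob G X"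
    and nat: "\<And>f. f \<in> Ar C \<Longrightarrow> Cmp D (\<eta> (Cod C f)) (far F f) = Cmp D (far G f) (\<eta> (Dom C f))"
    unfolding naturally_isomorphic_def Let_def C_def D_def by blast
  have "\<exists>h. \<forall>X\<in>Ob C. h X \<in> Ar D \<and> Dom D (h X) = fob G X \<and> Cod D (h X) = fob F X
      \<and> Cmp D (h X) (\<eta> X) = Idt D (fob F X) \<and> Cmp D (\<eta> X) (h X) = Idt D (fob G X)"
    using iso unfolding isomorphism_def by (intro bchoice) metis
  then obtain \<theta> where \<theta>: "\<And>X. X \<in> Ob C \<Longrightarrow> \<theta> X \<in> Ar D \<and> Dom D (\<theta> X) = fob G X \<and> Cod D (\<theta> X) = fob F X
      \<and> Cmp D (\<theta> X) (\<eta> X) = Idt D (fob F X) \<and> Cmp D (\<eta> X) (\<theta> X) = Idt D (fob G X)"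
    by blast
  have \<eta>: "\<eta> X \<in> Ar D" "Dom D (\<eta> X) = fob F X" "Cod D (\<eta> X) = fob G X" if "X \<in> Ob C" for X
    using iso[OF that] by (auto simp: isomorphism_def)
  note F' = covariantD[OF F, folded C_def D_def] and G' = covariantD[OF G, unfolded CG DG]
  have CD: "is_category C" "is_category D"
    using F' by auto
  \<comment> \<open>Laws for \<open>C\<close> come before those for \<open>D\<close>; thus
    \<open>cat(20)\<close>, \<open>cat(21)\<close> and \<open>cat(22)\<close> are right unit, left
    unit and associativity in \<open>D\<close>.\<close>
  note cat = is_categoryD[OF CD(1)] is_categoryD[OF CD(2)]
  have nat': "Cmp D (\<theta> (Cod C f)) (far G f) = Cmp D (far F f) (\<theta> (Dom C f))" if f: "f \<in> Ar C" for f
  proof -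
    let ?X = "Dom C f" and ?Y = "Cod C f"
    have X: "?X \<in> Ob C" and Y: "?Y \<in> Ob C"
      using f cat by auto
    \<comment> \<open>The identity \<open>\<eta> \<theta>\<close> is inserted at the domain, the
      naturality square of \<open>\<eta>\<close> is used in the middle, and
      \<open>\<theta> \<eta>\<close> is cancelled at the codomain.\<close>
    have "Cmp D (\<theta> ?Y) (far G f) = Cmp D (\<theta> ?Y) (Cmp D (far G f) (Cmp D (\<eta> ?X) (\<theta> ?X)))"
      using f X Y \<theta>[OF X] cat(20)[of "far G f"] by (simp add: G')
    also have "\<dots> = Cmp D (\<theta> ?Y) (Cmp D (Cmp D (far G f) (\<eta> ?X)) (\<theta> ?X))"
      using f X Y \<theta> \<eta> cat(22)[of "\<theta> ?X" "\<eta> ?X" "far G f"] by (simp add: G' F')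
    also have "\<dots> = Cmp D (Cmp D (\<theta> ?Y) (Cmp D (far G f) (\<eta> ?X))) (\<theta> ?X)"
      using f X Y \<theta> \<eta> cat(22)[of "\<theta> ?X" "Cmp D (far G f) (\<eta> ?X)" "\<theta> ?Y"]
      by (simp add: G' F' is_categoryD(6-8)[OF CD(2)])
    also have "\<dots> = Cmp D (Cmp D (\<theta> ?Y) (Cmp D (\<eta> ?Y) (far F f))) (\<theta> ?X)"
      by (simp add: nat[OF f])
    also have "\<dots> = Cmp D (Cmp D (Cmp D (\<theta> ?Y) (\<eta> ?Y)) (far F f)) (\<theta> ?X)"
      using f X Y \<theta> \<eta> cat(22)[of "far F f" "\<eta> ?Y" "\<theta> ?Y"] by (simp add: G' F')
    also have "\<dots> = Cmp D (far F f) (\<theta> ?X)"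
      using f Y \<theta>[OF Y] cat(21)[of "far F f"] by (simp add: F')
    finally show ?thesis .
  qed
  have iso': "isomorphism D (\<theta> X) \<and> Dom D (\<theta> X) = fob G X \<and> Cod D (\<theta> X) = fob F X" if X: "X \<in> Ob C" for X
    using \<theta>[OF X] \<eta>[OF X] unfolding isomorphism_def by auto
  show ?thesis
    using F G iso' nat' unfolding naturally_isomorphic_def Let_def CG DG C_def[symmetric] D_def[symmetric]
    by blast
qed

text \<open>The component at \<open>X\<close> is the image under \<open>P\<close> of the component
  at \<open>fob Q X\<close>; it is invertible because functors preserve isomorphisms. This carries
  the isomorphism of T S with the identity through E and its inverse.\<close>

lemma naturally_isomorphic_whisker:
  assumes HK: "naturally_isomorphic H K"
    and P: "covariant P" "Src P = Tgt H" and Q: "covariant Q" "Tgt Q = Src H"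
  shows "naturally_isomorphic (P \<circ>\<^sub>F H \<circ>\<^sub>F Q) (P \<circ>\<^sub>F K \<circ>\<^sub>F Q)"
proof -
  define C D where "C = Src H" and "D = Tgt H"
  from HK have H: "covariant H" and K: "covariant K" and CK: "Src K = C" and DK: "Tgt K = D"
    by (auto simp: naturally_isomorphic_def C_def D_def)
  from HK obtain \<eta> where
    iso: "\<And>X. X \<in> Ob C \<Longrightarrow> isomorphism D (\<eta> X) \<and> Dom D (\<eta> X) = fob H X \<and> Cod D (\<eta> X) = fob K X"
    and nat: "\<And>f. f \<in> Ar C \<Longrightarrow> Cmp D (\<eta> (Cod C f)) (far H f) = Cmp D (far K f) (\<eta> (Dom C f))"
    unfolding naturally_isomorphic_def Let_def C_def D_def by blast
  have \<eta>: "\<eta> X \<in> Ar D" "Dom D (\<eta> X) = fob H X" "Cod D (\<eta> X) = fob K X" if "X \<in> Ob C" for X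
    using iso[OF that] by (auto simp: isomorphism_def)
  note P' = covariantD[OF P(1), unfolded P(2), folded D_def]
    and Q' = covariantD[OF Q(1), unfolded Q(2), folded C_def]
    and H' = covariantD[OF H, folded C_def D_def] and K' = covariantD[OF K, unfolded CK DK]
  note [simp] = is_categoryD[OF Q'(1)] is_categoryD[OF Q'(2)] is_categoryD[OF P'(1)] is_categoryD[OF P'(2)]
  have cov: "covariant (P \<circ>\<^sub>F H \<circ>\<^sub>F Q)" "covariant (P \<circ>\<^sub>F K \<circ>\<^sub>F Q)"
    using P Q H K CK DK by (auto intro!: covariant_comp_functor simp: C_def D_def)
  have "isomorphism (Tgt P) (far P (\<eta> (fob Q X))) \<and>
      Dom (Tgt P) (far P (\<eta> (fob Q X))) = fob (P \<circ>\<^sub>F H \<circ>\<^sub>F Q) X \<and>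
      Cod (Tgt P) (far P (\<eta> (fob Q X))) = fob (P \<circ>\<^sub>F K \<circ>\<^sub>F Q) X" if X: "X \<in> Ob (Src Q)" for X
    using X \<eta>[of "fob Q X"] iso[of "fob Q X"] isomorphism_image[OF P(1), of "\<eta> (fob Q X)"]
    by (simp add: Q' P' P(2) D_def)
  moreover have "Cmp (Tgt P) (far P (\<eta> (fob Q (Cod (Src Q) f)))) (far (P \<circ>\<^sub>F H \<circ>\<^sub>F Q) f) =
      Cmp (Tgt P) (far (P \<circ>\<^sub>F K \<circ>\<^sub>F Q) f) (far P (\<eta> (fob Q (Dom (Src Q) f))))" if f: "f \<in> Ar (Src Q)" for f
    using f nat[of "far Q f"] \<eta>[of "fob Q (Dom (Src Q) f)"] \<eta>[of "fob Q (Cod (Src Q) f)"]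
    by (simp add: Q' H' K' P'(8)[symmetric])
  ultimately show ?thesis
    using cov unfolding naturally_isomorphic_def Let_def by (intro conjI exI[of _ "\<lambda>X. far P (\<eta> (fob Q X))"]) simp_all
qed

text \<open>\<open>E\<close> is an isomorphism of categories with inverse \<open>J\<close>. One
  round trip, S J E T, collapses literally to S T. The other, E T S J, is a whiskered copy of T S,
  hence isomorphic to E J, which is the identity.\<close>

lemma dual_equivalences_transport:
  assumes TS: "dual_equivalences T S"
    and E: "covariant E" "Src E = Src S" and J: "covariant J" "Src J = Tgt E" "Tgt J = Src S"
    and JE: "J \<circ>\<^sub>F E = id_functor (Src E)" and EJ: "E \<circ>\<^sub>F J = id_functor (Src J)"
  shows "dual_equivalences (E \<circ>\<^sub>F T) (S \<circ>\<^sub>F J)"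
proof -
  from TS have T: "contravariant T" and S: "contravariant S" and ST: "Src S = Tgt T" "Tgt S = Src T"
    and iso: "naturally_isomorphic (S \<circ>\<^sub>F T) (id_functor (Src T))"
      "naturally_isomorphic (T \<circ>\<^sub>F S) (id_functor (Src S))"
    unfolding dual_equivalences_def by auto
  note T' = contravariantD[OF T] and S' = contravariantD[OF S]
    and E' = covariantD[OF E(1)] and J' = covariantD[OF J(1)]
  \<comment> \<open>Equality of two extensional functors is unpacked into equality of values on
    objects, and in the next fact on arrows.\<close>
  have JEx: "fob J (fob E X) = X" if "X \<in> Ob (Src E)" for X
    using arg_cong[OF JE, of fob] that by (auto simp: comp_functor_def id_functor_def mk_functor_def fun_eq_iff restrict_def split: if_splits)
  have JEf: "far J (far E f) = f" if "f \<in> Ar (Src E)" for f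
    using arg_cong[OF JE, of far] that by (auto simp: comp_functor_def id_functor_def mk_functor_def fun_eq_iff restrict_def split: if_splits)
  have "(S \<circ>\<^sub>F J) \<circ>\<^sub>F (E \<circ>\<^sub>F T) = S \<circ>\<^sub>F T"
    using T' E' E(2) J(2) ST JEx JEf
    by (simp add: comp_functor_def cong: mk_functor_cong)
  moreover have "(E \<circ>\<^sub>F T) \<circ>\<^sub>F (S \<circ>\<^sub>F J) = E \<circ>\<^sub>F (T \<circ>\<^sub>F S) \<circ>\<^sub>F J"
    using S' J' E(2) J(2,3) ST
    by (simp add: comp_functor_def cong: mk_functor_cong)
  moreover have "E \<circ>\<^sub>F id_functor (Src S) \<circ>\<^sub>F J = E \<circ>\<^sub>F J"
    using J' J(3) by (simp add: comp_functor_def id_functor_def cong: mk_functor_cong)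
  moreover have "naturally_isomorphic (E \<circ>\<^sub>F (T \<circ>\<^sub>F S) \<circ>\<^sub>F J) (E \<circ>\<^sub>F id_functor (Src S) \<circ>\<^sub>F J)"
    by (rule naturally_isomorphic_whisker) (use iso E J ST in \<open>simp_all add: comp_functor_def\<close>)
  moreover have "contravariant (E \<circ>\<^sub>F T)" "contravariant (S \<circ>\<^sub>F J)"
    using T S E J ST by (auto intro: contravariant_comp_left contravariant_comp_right)
  ultimately show ?thesis
    using iso EJ J ST unfolding dual_equivalences_def by (simp add: comp_functor_def)
qed

section \<open>Formal identities between composite functors\<close>

lemma id_functor_sel [simp]:
  "Src (id_functor C) = C" "Tgt (id_functor C) = C"
  "X \<in> Ob C \<Longrightarrow> fob (id_functor C) X = X" "f \<in> Ar C \<Longrightarrow> far (id_functor C) f = f"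
  by (simp_all add: id_functor_def)

text \<open>The composite of \<open>H\<close> and \<open>G\<close> takes the value
  \<open>undefined\<close> outside the source of \<open>G\<close>, so the two bracketings agree only
  if the values of \<open>F\<close> lie in that source. Functoriality of \<open>F\<close>, of either
  variance, guarantees this.\<close>

lemma comp_functor_assoc:
  assumes "covariant F \<or> contravariant F" "Src G = Tgt F"
  shows "(H \<circ>\<^sub>F G) \<circ>\<^sub>F F = H \<circ>\<^sub>F G \<circ>\<^sub>F F"
proof -
  have "fob F X \<in> Ob (Src G)" if "X \<in> Ob (Src F)" for X
    using assms that covariantD(3) contravariantD(3) by metis
  moreover have "far F f \<in> Ar (Src G)" if "f \<in> Ar (Src F)" for f
    using assms that covariantD(4) contravariantD(4) by metis
  ultimately show ?thesis
    unfolding comp_functor_def by (intro mk_functor_cong) simp_all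
qed

lemma id_functor_comp_mk_functor:
  assumes "contravariant (mk_functor C D p q)"
  shows "id_functor D \<circ>\<^sub>F mk_functor C D p q = mk_functor C D p q"
proof -
  have "p X \<in> Ob D" if "X \<in> Ob C" for X
    using contravariantD(3)[OF assms, of X] that by simp
  moreover have "q f \<in> Ar D" if "f \<in> Ar C" for f
    using contravariantD(4)[OF assms, of f] that by simp
  ultimately show ?thesis
    unfolding comp_functor_def by (intro mk_functor_cong) simp_all
qed

lemma mk_functor_comp_id_functor: "mk_functor C D p q \<circ>\<^sub>F id_functor C = mk_functor C D p q"
  unfolding comp_functor_def by (intro mk_functor_cong) simp_all

text \<open>Both sides have the values of \<open>F\<close>. Contravariance of the restriction puts
  these values into \<open>D\<close>, where the inclusion functor acts as the identity.\<close>

lemma comp_inclusion_eq_inclusion_comp: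
  assumes "contravariant (restrict_functor F C D)"
  shows "F \<circ>\<^sub>F inclusion_functor C C' = inclusion_functor D (Tgt F) \<circ>\<^sub>F restrict_functor F C D"
proof -
  have "fob F X \<in> Ob D" if "X \<in> Ob C" for X
    using contravariantD(3)[OF assms, of X] that by (simp add: restrict_functor_def)
  moreover have "far F f \<in> Ar D" if "f \<in> Ar C" for f
    using contravariantD(4)[OF assms, of f] that by (simp add: restrict_functor_def)
  ultimately show ?thesis
    unfolding comp_functor_def inclusion_functor_def restrict_functor_def
    by (intro mk_functor_cong) simp_all
qed

section \<open>The prime filter theorem\<close>

lemma pts_iff:
  "x \<in> pts A \<longleftrightarrow> x \<in> extensional (carrier A) \<and>
     (\<forall>a\<in>carrier A. \<forall>b\<in>carrier A. x (meet A a b) \<longleftrightarrow> x a \<and> x b) \<and>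
     (\<forall>a\<in>carrier A. \<forall>b\<in>carrier A. x (join A a b) \<longleftrightarrow> x a \<or> x b) \<and>
     (\<forall>a\<in>carrier A. x (compl A a) \<longleftrightarrow> \<not> x a) \<and> \<not> x (zero A) \<and> x (one A)"
  unfolding pts_def boolean_homs_def two_def by (auto simp: PiE_def)

context boolean_algebra_on
begin

text \<open>Idempotence and absorption are not among the locale axioms. Here \<open>a\<close> is
  expanded as its meet with \<open>join A a (compl A a)\<close>; absorption comes from writing
  \<open>a\<close> as \<open>join A a (zero A)\<close> and factoring.\<close>

lemma meet_idem: "a \<in> carrier A \<Longrightarrow> meet A a a = a"
  using meet_join_distrib[of a a "compl A a"]
  by (simp add: compl_closed join_compl join_zero meet_closed meet_compl meet_one)

lemma meet_zero: "a \<in> carrier A \<Longrightarrow> meet A a (zero A) = zero A"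
  using meet_assoc[of a a "compl A a"] by (simp add: compl_closed meet_compl meet_idem)

lemma meet_absorb: "\<lbrakk>a \<in> carrier A; b \<in> carrier A\<rbrakk> \<Longrightarrow> meet A a (join A a b) = a"
  using join_meet_distrib[of a "zero A" b]
  by (simp add: join_zero meet_commute[of "zero A"] meet_zero zero_closed)

lemma meet_left_commute:
  "\<lbrakk>a \<in> carrier A; b \<in> carrier A; c \<in> carrier A\<rbrakk> \<Longrightarrow> meet A a (meet A b c) = meet A b (meet A a c)"
  using meet_assoc[of a b c] meet_assoc[of b a c] by (simp add: meet_commute[of a b])

text \<open>Two witnesses that exclude \<open>a\<close> and \<open>b\<close> from a maximal set
  combine into one that excludes their join. Primeness and the complement law for that set both rest
  on this.\<close>

lemma meet_join_eq_zero:
  assumes "m \<in> carrier A" "n \<in> carrier A" "a \<in> carrier A" "b \<in> carrier A"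
    and "meet A m a = zero A" "meet A n b = zero A"
  shows "meet A (meet A m n) (join A a b) = zero A"
proof -
  have "meet A (meet A m n) a = zero A" "meet A (meet A m n) b = zero A"
    using assms by (simp_all add: meet_assoc meet_zero meet_left_commute[of m n a])
  then show ?thesis
    using assms by (simp add: meet_join_distrib meet_closed join_zero zero_closed)
qed

text \<open>
  Zorn's lemma is applied to the multiplicatively closed sets avoiding zero: a maximal one is
  an ultrafilter, and no filter has to be generated.
\<close>

lemma prime_filter:
  assumes M0: "M0 \<subseteq> carrier A" "one A \<in> M0" "\<And>a b. \<lbrakk>a \<in> M0; b \<in> M0\<rbrakk> \<Longrightarrow> meet A a b \<in> M0"
    and "zero A \<notin> M0"
  obtains x where "x \<in> pts A" "\<And>a. a \<in> M0 \<Longrightarrow> x a"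
proof -
  define \<M> where "\<M> = {M. M0 \<subseteq> M \<and> M \<subseteq> carrier A \<and> (\<forall>a\<in>M. \<forall>b\<in>M. meet A a b \<in> M) \<and> zero A \<notin> M}"
  have "\<exists>M\<in>\<M>. \<forall>X\<in>\<M>. M \<subseteq> X \<longrightarrow> X = M"
  proof (rule subset_Zorn_nonempty)
    have "M0 \<in> \<M>"
      using assms by (simp add: \<M>_def)
    then show "\<M> \<noteq> {}"
      by blast
    fix \<C> assume "\<C> \<noteq> {}" and \<C>: "subset.chain \<M> \<C>"
    have in_\<C>: "M0 \<subseteq> M \<and> M \<subseteq> carrier A \<and> (\<forall>a\<in>M. \<forall>b\<in>M. meet A a b \<in> M) \<and> zero A \<notin> M" if "M \<in> \<C>" for M
      using \<C> that by (auto simp: subset_chain_def \<M>_def)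
    have "meet A a b \<in> \<Union>\<C>" if ab: "a \<in> \<Union>\<C>" "b \<in> \<Union>\<C>" for a b
    proof -
      obtain M N where MN: "M \<in> \<C>" "a \<in> M" "N \<in> \<C>" "b \<in> N"
        using ab by blast
      then have "M \<subseteq> N \<or> N \<subseteq> M"
        using \<C> unfolding subset_chain_def by blast
      with MN obtain M where "M \<in> \<C>" "a \<in> M" "b \<in> M"
        by (metis subsetD)
      then show ?thesis
        using in_\<C>[of M] by blast
    qed
    moreover have "M0 \<subseteq> \<Union>\<C>" "\<Union>\<C> \<subseteq> carrier A" "zero A \<notin> \<Union>\<C>"
      using \<open>\<C> \<noteq> {}\<close> in_\<C> by blast+
    ultimately show "\<Union>\<C> \<in> \<M>"
      by (simp add: \<M>_def)
  qed
  then obtain M where M: "M \<in> \<M>" and max: "\<And>X. \<lbrakk>X \<in> \<M>; M \<subseteq> X\<rbrakk> \<Longrightarrow> X = M"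
    by blast
  have sub: "M0 \<subseteq> M" and car: "\<And>a. a \<in> M \<Longrightarrow> a \<in> carrier A"
    and meet: "\<And>a b. \<lbrakk>a \<in> M; b \<in> M\<rbrakk> \<Longrightarrow> meet A a b \<in> M" and zero: "zero A \<notin> M"
    using M unfolding \<M>_def by auto
  have one: "one A \<in> M"
    using sub M0 by blast
  have avoid: "\<exists>m\<in>M. meet A m a = zero A" if a: "a \<in> carrier A" "a \<notin> M" for a
  proof (rule ccontr)
    assume *: "\<not> ?thesis"
    \<comment> \<open>\<open>X\<close> adjoins \<open>a\<close> multiplicatively: it contains
      \<open>a\<close> because \<open>one A\<close> is in \<open>M\<close>, and idempotence keeps it
      closed. If no member of \<open>M\<close> is disjoint from \<open>a\<close>, then
      \<open>X\<close> still avoids zero and maximality forces \<open>a\<close> into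
      \<open>M\<close>.\<close>
    define X where "X = M \<union> (\<lambda>m. meet A m a) ` M"
    have closed: "meet A b c \<in> X" if "b \<in> X" "c \<in> X" for b c
    proof -
      have "meet A m (meet A n a) = meet A (meet A m n) a"
        "meet A (meet A m a) n = meet A (meet A m n) a"
        "meet A (meet A m a) (meet A n a) = meet A (meet A m n) a" if "m \<in> M" "n \<in> M" for m n
        using car[OF that(1)] car[OF that(2)] a(1)
        by (simp_all add: meet_assoc meet_closed meet_commute[of a n] meet_left_commute[of a n a] meet_idem)
      with that show ?thesis
        unfolding X_def by (auto intro: meet)
    qed
    have "X \<subseteq> carrier A" "zero A \<notin> X" "M0 \<subseteq> X" "M \<subseteq> X"
      using car a zero sub * by (auto simp: X_def meet_closed)
    then have "X = M"
      using closed by (intro max) (auto simp: \<M>_def)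
    moreover have "meet A (one A) a \<in> X"
      unfolding X_def using one by blast
    ultimately show False
      using a by (simp add: meet_commute one_closed meet_one)
  qed
  define x where "x = (\<lambda>a\<in>carrier A. a \<in> M)"
  have disjoint: "\<not> (meet A m a = zero A)" if "m \<in> M" "a \<in> M" for m a
    using that meet zero by metis
  have "meet A a b \<in> M \<longleftrightarrow> a \<in> M \<and> b \<in> M" if ab: "a \<in> carrier A" "b \<in> carrier A" for a b
  proof
    \<comment> \<open>If \<open>a\<close> were excluded by some \<open>m\<close>, then
      \<open>m\<close> would also be disjoint from \<open>meet A a b\<close>, although both lie in
      \<open>M\<close>.\<close>
    have upward: "a \<in> M" if ab: "a \<in> carrier A" "b \<in> carrier A" "meet A a b \<in> M" for a b
    proof (rule ccontr)
      assume "a \<notin> M"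
      with avoid ab obtain m where m: "m \<in> M" "meet A m a = zero A"
        by blast
      have "meet A m (meet A a b) = zero A"
        using m ab car[of m] meet_assoc[of m a b]
        by (simp add: meet_commute[of "zero A"] meet_zero zero_closed)
      with m ab(3) disjoint show False
        by blast
    qed
    show "meet A a b \<in> M \<Longrightarrow> a \<in> M \<and> b \<in> M"
      using upward[of a b] upward[of b a] ab by (simp add: meet_commute)
  qed (use meet in blast)
  moreover have "join A a b \<in> M \<longleftrightarrow> a \<in> M \<or> b \<in> M" if ab: "a \<in> carrier A" "b \<in> carrier A" for a b
  proof
    assume j: "join A a b \<in> M"
    show "a \<in> M \<or> b \<in> M"
    proof (rule ccontr)
      assume "\<not> ?thesis"
      with avoid ab obtain m n where mn: "m \<in> M" "meet A m a = zero A" "n \<in> M" "meet A n b = zero A"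
        by blast
      then have "meet A (meet A m n) (join A a b) = zero A"
        using ab car by (intro meet_join_eq_zero)
      with mn j meet disjoint show False
        by blast
    qed
  next
    have "join A a b \<in> M" if ab: "a \<in> carrier A" "b \<in> carrier A" and "a \<in> M" for a b
    proof (rule ccontr)
      assume "join A a b \<notin> M"
      with avoid ab obtain m where m: "m \<in> M" "meet A m (join A a b) = zero A"
        by (metis join_closed)
      have "meet A m a = meet A a (meet A m (join A a b))"
        using ab car[OF m(1)] by (simp add: join_closed meet_absorb meet_left_commute[of a m])
      also have "\<dots> = zero A"
        using m ab by (simp add: meet_zero)
      finally show False
        using m \<open>a \<in> M\<close> disjoint by blast
    qed
    from this[of a b] this[of b a] show "a \<in> M \<or> b \<in> M \<Longrightarrow> join A a b \<in> M"
      using ab by (auto simp: join_commute)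
  qed
  moreover have "compl A a \<in> M \<longleftrightarrow> a \<notin> M" if a: "a \<in> carrier A" for a
  proof
    assume "a \<notin> M"
    show "compl A a \<in> M"
    proof (rule ccontr)
      assume "compl A a \<notin> M"
      with \<open>a \<notin> M\<close> avoid a obtain m n
        where mn: "m \<in> M" "meet A m a = zero A" "n \<in> M" "meet A n (compl A a) = zero A"
        by (metis compl_closed)
      \<comment> \<open>The join is \<open>one A\<close>, a member of \<open>M\<close>, so
        \<open>meet A m n\<close>, another member, cannot be disjoint from it.\<close>
      then have "meet A (meet A m n) (join A a (compl A a)) = zero A"
        using a car by (intro meet_join_eq_zero compl_closed)
      with mn a one meet disjoint show False
        by (metis join_compl)
    qed
  qed (use disjoint a meet_compl in blast)
  ultimately have "x \<in> pts A"
    using one zero unfolding pts_iff x_def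
    by (simp add: meet_closed join_closed compl_closed one_closed zero_closed)
  moreover have "x a" if "a \<in> M0" for a
    using that sub car unfolding x_def by auto
  ultimately show ?thesis ..
qed

lemma exists_point:
  assumes a: "a \<in> carrier A" "a \<noteq> zero A"
  shows "\<exists>x\<in>pts A. x a"
proof (rule prime_filter[of "{one A, a}"])
  show "meet A b c \<in> {one A, a}" if "b \<in> {one A, a}" "c \<in> {one A, a}" for b c
    using that a by (auto simp: meet_idem meet_one meet_commute[of "one A"] one_closed)
  \<comment> \<open>If one and zero coincided, every \<open>a\<close> would equal its meet with zero
    and hence be zero.\<close>
  have "one A \<noteq> zero A"
    using a meet_one meet_zero by metis
  then show "zero A \<notin> {one A, a}"
    using a by auto
qed (use a one_closed in auto)

section \<open>The Stone space of a Boolean algebra\<close>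

lemma basic_meet: "\<lbrakk>a \<in> carrier A; b \<in> carrier A\<rbrakk> \<Longrightarrow> basic A (meet A a b) = basic A a \<inter> basic A b"
  and basic_join: "\<lbrakk>a \<in> carrier A; b \<in> carrier A\<rbrakk> \<Longrightarrow> basic A (join A a b) = basic A a \<union> basic A b"
  and basic_compl: "a \<in> carrier A \<Longrightarrow> basic A (compl A a) = pts A - basic A a"
  and basic_zero: "basic A (zero A) = {}"
  and basic_one: "basic A (one A) = pts A"
  by (auto simp: basic_def pts_iff)

text \<open>The difference \<open>meet A a (compl A b)\<close> has an empty basic set, so by
  \<open>exists_point\<close> it is zero. This gives \<open>a\<close> below \<open>b\<close>, and
  the argument is symmetric.\<close>

lemma basic_inject:
  assumes ab: "a \<in> carrier A" "b \<in> carrier A" and eq: "basic A a = basic A b"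
  shows "a = b"
proof -
  have "a = meet A a b" if ab: "a \<in> carrier A" "b \<in> carrier A" "basic A a = basic A b" for a b
  proof -
    have "basic A (meet A a (compl A b)) = {}"
      using ab by (simp add: basic_meet basic_compl compl_closed)
    then have "meet A a (compl A b) = zero A"
      using exists_point[of "meet A a (compl A b)"] ab by (auto simp: basic_def meet_closed compl_closed)
    then have "meet A a (join A b (compl A b)) = meet A a b"
      using ab by (simp add: meet_join_distrib compl_closed join_zero meet_closed)
    then show ?thesis
      using ab by (simp add: join_compl meet_one)
  qed
  from this[of a b] this[of b a] show ?thesis
    using assms by (metis meet_commute)
qed

text \<open>\<open>topology\<close> returns the intended open sets only if they form a topology; for
  unions of basic sets this follows from closure of the basic sets under binary intersection, that
  is, from \<open>basic_meet\<close>.\<close>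

lemma openin_stone_topology:
  "openin (stone_topology A) = arbitrary union_of (\<lambda>U. \<exists>a\<in>carrier A. U = basic A a)"
  unfolding stone_topology_def
  by (rule topology_inverse', rule istopology_base) (metis basic_meet meet_closed)

lemma openin_basic: "a \<in> carrier A \<Longrightarrow> openin (stone_topology A) (basic A a)"
  using openin_stone_topology unfolding openin_topology_base_unique by blast

lemma openin_stone_topologyE:
  assumes "openin (stone_topology A) U" "x \<in> U"
  obtains a where "a \<in> carrier A" "x \<in> basic A a" "basic A a \<subseteq> U"
  using openin_stone_topology assms unfolding openin_topology_base_unique by blast

lemma topspace_stone_topology: "topspace (stone_topology A) = pts A"
proof
  show "topspace (stone_topology A) \<subseteq> pts A"
    by (rule subsetI, erule openin_stone_topologyE[OF openin_topspace]) (simp add: basic_def)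
  show "pts A \<subseteq> topspace (stone_topology A)"
    using openin_subset[OF openin_basic[OF one_closed]] by (simp add: basic_one)
qed

lemma closedin_basic: "a \<in> carrier A \<Longrightarrow> closedin (stone_topology A) (basic A a)"
  using openin_basic[of "compl A a"]
  by (simp add: closedin_def topspace_stone_topology basic_compl compl_closed) (simp add: basic_def)

lemma Hausdorff_stone_topology: "Hausdorff_space (stone_topology A)"
  unfolding Hausdorff_space_def topspace_stone_topology
proof (intro allI impI, elim conjE)
  fix x y assume xy: "x \<in> pts A" "y \<in> pts A" "x \<noteq> y"
  then have ext: "x \<in> extensional (carrier A)" "y \<in> extensional (carrier A)"
    by (simp_all add: pts_iff)
  obtain a where a: "a \<in> carrier A" "x a \<noteq> y a"
    using extensionalityI[OF ext] xy(3) by blast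
  \<comment> \<open>Whichever of \<open>a\<close> and its complement \<open>x\<close> sends to 1 is
    sent to 0 by \<open>y\<close>.\<close>
  define b where "b = (if x a then a else compl A a)"
  have b: "b \<in> carrier A" "x \<in> basic A b" "y \<in> basic A (compl A b)"
    using xy a unfolding b_def basic_def by (auto simp: pts_iff compl_closed)
  moreover have "disjnt (basic A b) (basic A (compl A b))"
    unfolding basic_compl[OF b(1)] disjnt_def by blast
  ultimately show "\<exists>U V. openin (stone_topology A) U \<and> openin (stone_topology A) V \<and> x \<in> U \<and> y \<in> V \<and> disjnt U V"
    using openin_basic compl_closed by metis
qed

text \<open>
  If a cover \<open>\<U>\<close> has no finite subcover, then the elements containing the complement of a finite
  union of members of \<open>\<U>\<close> form a proper filter, and an ultrafilter extending it is a point that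
  is not covered.
\<close>

lemma compact_stone_topology: "compact_space (stone_topology A)"
  unfolding compact_space_alt topspace_stone_topology
proof (intro allI impI, elim conjE, rule ccontr)
  fix \<U> assume open_\<U>: "\<forall>U\<in>\<U>. openin (stone_topology A) U" and cover: "pts A \<subseteq> \<Union>\<U>"
    and none: "\<not> (\<exists>\<F>. finite \<F> \<and> \<F> \<subseteq> \<U> \<and> pts A \<subseteq> \<Union>\<F>)"
  define M where "M = {a \<in> carrier A. \<exists>\<F>. finite \<F> \<and> \<F> \<subseteq> \<U> \<and> pts A - \<Union>\<F> \<subseteq> basic A a}"
  obtain x where x: "x \<in> pts A" "\<And>a. a \<in> M \<Longrightarrow> x a"
  proof (rule prime_filter[of M])
    show "one A \<in> M"
      unfolding M_def using one_closed by (simp add: basic_one exI[of _ "{}"])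
    show "zero A \<notin> M"
    proof
      assume "zero A \<in> M"
      then obtain \<F> where "finite \<F>" "\<F> \<subseteq> \<U>" "pts A - \<Union>\<F> \<subseteq> {}"
        by (auto simp: M_def basic_zero)
      then have "finite \<F> \<and> \<F> \<subseteq> \<U> \<and> pts A \<subseteq> \<Union>\<F>"
        by auto
      with none show False
        by metis
    qed
    fix a b assume "a \<in> M" "b \<in> M"
    then obtain \<F> \<G> where "a \<in> carrier A" "finite \<F>" "\<F> \<subseteq> \<U>" "pts A - \<Union>\<F> \<subseteq> basic A a"
      "b \<in> carrier A" "finite \<G>" "\<G> \<subseteq> \<U>" "pts A - \<Union>\<G> \<subseteq> basic A b"
      unfolding M_def by blast
    then show "meet A a b \<in> M"
      unfolding M_def by (auto simp: meet_closed basic_meet intro!: exI[of _ "\<F> \<union> \<G>"])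
  qed (auto simp: M_def)
  then obtain U where U: "U \<in> \<U>" "x \<in> U"
    using cover by blast
  have "openin (stone_topology A) U"
    using open_\<U> U by simp
  then obtain a where a: "a \<in> carrier A" "x \<in> basic A a" "basic A a \<subseteq> U"
    using U(2) by (rule openin_stone_topologyE)
  \<comment> \<open>The single set \<open>U\<close> serves as the finite subfamily: what it leaves
    uncovered lies outside \<open>basic A a\<close>. So \<open>x\<close> sends both \<open>a\<close>
    and its complement to 1.\<close>
  then have "compl A a \<in> M"
    unfolding M_def using U by (auto simp: compl_closed basic_compl intro!: exI[of _ "{U}"])
  then show False
    using x a by (auto simp: basic_def pts_iff)
qed

text \<open>A clopen set is compact, and it is covered by the basic sets that it contains. Finitely
  many of them suffice, and a finite union of basic sets is the basic set of a join.\<close>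

lemma clopen_stone_topology_iff:
  "openin (stone_topology A) U \<and> closedin (stone_topology A) U \<longleftrightarrow> (\<exists>a\<in>carrier A. U = basic A a)"
proof (intro iffI conjI; (elim conjE)?)
  assume op: "openin (stone_topology A) U" and cl: "closedin (stone_topology A) U"
  have "compactin (stone_topology A) U"
    using compact_stone_topology cl by (rule closedin_compact_space)
  moreover have "\<forall>V \<in> {basic A a |a. a \<in> carrier A \<and> basic A a \<subseteq> U}. openin (stone_topology A) V"
    by (auto simp: openin_basic)
  moreover have "U \<subseteq> \<Union>{basic A a |a. a \<in> carrier A \<and> basic A a \<subseteq> U}"
  proof
    fix x assume "x \<in> U"
    with op obtain a where "a \<in> carrier A" "x \<in> basic A a" "basic A a \<subseteq> U"
      by (rule openin_stone_topologyE)
    then show "x \<in> \<Union>{basic A a |a. a \<in> carrier A \<and> basic A a \<subseteq> U}"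
      by auto
  qed
  ultimately obtain \<F> where \<F>: "finite \<F>" "\<F> \<subseteq> {basic A a |a. a \<in> carrier A \<and> basic A a \<subseteq> U}" "U \<subseteq> \<Union>\<F>"
    unfolding compactin_def by meson
  have "\<exists>a\<in>carrier A. \<Union>\<F> = basic A a"
    using \<F>(1,2)
  proof (induction \<F>)
    case empty
    show ?case
      using basic_zero zero_closed by auto
  next
    case (insert V \<F>)
    then obtain a where "a \<in> carrier A" "\<Union>\<F> = basic A a"
      by auto
    moreover from insert obtain b where "b \<in> carrier A" "V = basic A b"
      by auto
    ultimately have "\<Union>(insert V \<F>) = basic A (join A b a)" "join A b a \<in> carrier A"
      by (simp_all add: basic_join join_closed)
    then show ?case
      by blast
  qed
  moreover have "\<Union>\<F> = U"
    using \<F> by blast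
  ultimately show "\<exists>a\<in>carrier A. U = basic A a"
    by simp
qed (auto simp: openin_basic closedin_basic)

text \<open>The z-condition is \<open>exists_point\<close>, the dz-condition is the description of
  the clopen sets. This is what places compact dz-algebras among the objects of
  \<open>dzBoole\<close>.\<close>

lemma dz_algebra_pts: "dz_algebra (A, pts A)"
proof -
  have "subtopology (stone_topology A) (pts A) = stone_topology A"
    by (metis subtopology_topspace topspace_stone_topology)
  moreover have "pts A \<inter> basic A a = basic A a" for a
    by (auto simp: basic_def)
  ultimately show ?thesis
    using boolean_algebra_on_axioms exists_point
    unfolding dz_algebra_def z_algebra_def by (auto simp: clopen_stone_topology_iff)
qed

end

section \<open>Codes in the universe\<close>

lemma code_elts [simp]: "code (elts u) = u"
  unfolding code_def by (rule inv_f_f) (simp add: inj_def elts_inject)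

lemma elts_code: "small S \<Longrightarrow> elts (code S) = S"
  unfolding code_def small_def by (simp add: f_inv_into_f)

lemma small_subset: "\<lbrakk>small S; R \<subseteq> S\<rbrakk> \<Longrightarrow> small R"
  unfolding small_def using elts_subset by (metis rangeE rangeI)

lemma elts_code_subset: "\<lbrakk>small S; R \<subseteq> S\<rbrakk> \<Longrightarrow> elts (code R) = R"
  by (simp add: elts_code small_subset)

text \<open>All codes of subsets of \<open>S\<close> lie in the power set supplied by the universe.
  This keeps both the clopen algebra of a small space and the point set of a small algebra inside
  the universe.\<close>

lemma small_image_code:
  fixes S :: "'u::set_universe set"
  assumes "small S" "\<And>R. R \<in> \<K> \<Longrightarrow> R \<subseteq> S"
  shows "small (code ` \<K>)"
proof -
  obtain s :: 'u where s: "S = elts s"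
    using assms(1) unfolding small_def by blast
  obtain p :: 'u where p: "elts p = {y. elts y \<subseteq> elts s}"
    using elts_power by blast
  have "code R \<in> elts p" if "R \<in> \<K>" for R
    using assms(2)[OF that] elts_code_subset[OF assms(1), of R] by (simp add: p s)
  then have "code ` \<K> \<subseteq> elts p"
    by blast
  then show ?thesis
    by (meson rangeI small_def small_subset)
qed

lemma elts_code_point: "small (carrier A) \<Longrightarrow> elts (code_point A x) = {a \<in> carrier A. x a}"
  unfolding code_point_def by (rule elts_code_subset) auto

lemma decode_code_point: "\<lbrakk>small (carrier A); x \<in> pts A\<rbrakk> \<Longrightarrow> decode A (code_point A x) = x"
  unfolding decode_def pts_iff by (auto simp: elts_code_point fun_eq_iff extensional_def)

locale small_boolean_algebra = boolean_algebra_on A for A :: "'u::set_universe boolalg" +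
  assumes small_carrier: "small (carrier A)"
begin

lemmas decode_code_point' = decode_code_point[OF small_carrier]

lemma topspace_S_ob: "topspace (S_ob A) = code_point A ` pts A"
  using decode_code_point' unfolding S_ob_def encode_def
  by (auto simp: topspace_pullback_topology topspace_stone_topology)

text \<open>The coded space is a pullback along \<open>decode\<close>, which is inverse to
  \<open>code_point\<close> on homomorphisms; preimages under the former are therefore images under
  the latter.\<close>

lemma openin_S_ob: "openin (S_ob A) W \<longleftrightarrow> (\<exists>U. openin (stone_topology A) U \<and> W = code_point A ` U)"
proof -
  have "decode A -` U \<inter> code_point A ` pts A = code_point A ` U" if "openin (stone_topology A) U" for U
    using openin_subset[OF that] decode_code_point'
    by (force simp: topspace_stone_topology)
  then show ?thesis
    unfolding S_ob_def encode_def openin_pullback_topology topspace_stone_topology by metis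
qed

text \<open>Coding only renames points. Through this homeomorphism the facts about
  \<open>stone_topology\<close> pass to the space that is an object of \<open>Stone\<close>.\<close>

lemma code_point_homeomorphic: "homeomorphic_map (stone_topology A) (S_ob A) (code_point A)"
proof (rule bijective_open_imp_homeomorphic_map)
  have inj: "inj_on (code_point A) (pts A)"
    using decode_code_point' by (rule inj_on_inverseI)
  then show "inj_on (code_point A) (topspace (stone_topology A))"
    by (simp add: topspace_stone_topology)
  show "code_point A ` topspace (stone_topology A) = topspace (S_ob A)"
    by (simp add: topspace_stone_topology topspace_S_ob)
  show "open_map (stone_topology A) (S_ob A) (code_point A)"
    unfolding open_map_def openin_S_ob by blast
  show "continuous_map (stone_topology A) (S_ob A) (code_point A)"
    unfolding continuous_map
  proof (intro conjI allI impI)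
    fix W assume "openin (S_ob A) W"
    then obtain U where U: "openin (stone_topology A) U" "W = code_point A ` U"
      unfolding openin_S_ob by blast
    have "{x \<in> topspace (stone_topology A). code_point A x \<in> W} = U"
      using inj openin_subset[OF U(1)] unfolding U(2) topspace_stone_topology inj_on_def by blast
    then show "openin (stone_topology A) {x \<in> topspace (stone_topology A). code_point A x \<in> W}"
      using U(1) by simp
  qed (simp add: topspace_stone_topology topspace_S_ob)
qed

lemma code_point_basic:
  assumes "a \<in> carrier A"
  shows "code_point A ` basic A a = {p \<in> topspace (S_ob A). a \<in> elts p}"
  using assms by (auto simp: topspace_S_ob basic_def elts_code_point[OF small_carrier])

text \<open>A coded point is its own ultrafilter, so the basic set of \<open>a\<close> turns into a
  membership condition. Continuity and naturality are later checked in this form.\<close>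

lemma clopen_S_ob_iff: "openin (S_ob A) W \<and> closedin (S_ob A) W \<longleftrightarrow> (\<exists>a\<in>carrier A. W = {p \<in> topspace (S_ob A). a \<in> elts p})"
proof -
  note h = code_point_homeomorphic
  have "openin (S_ob A) W \<and> closedin (S_ob A) W \<longleftrightarrow>
      (\<exists>U. openin (stone_topology A) U \<and> closedin (stone_topology A) U \<and> W = code_point A ` U)"
  proof
    assume "openin (S_ob A) W \<and> closedin (S_ob A) W"
    moreover from this obtain U where "openin (stone_topology A) U" "W = code_point A ` U"
      unfolding openin_S_ob by blast
    ultimately show "\<exists>U. openin (stone_topology A) U \<and> closedin (stone_topology A) U \<and> W = code_point A ` U"
      using homeomorphic_map_closedness[OF h] openin_subset by blast
  qed (use homeomorphic_map_closedness[OF h] homeomorphic_map_openness[OF h] openin_subset in blast)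
  then show ?thesis
    using clopen_stone_topology_iff code_point_basic by metis
qed

lemma S_ob_Stone: "Hausdorff_space (S_ob A)" "compact_space (S_ob A)" "zero_dimensional (S_ob A)"
    "small (topspace (S_ob A))"
proof -
  note h = code_point_homeomorphic
  then have hs: "stone_topology A homeomorphic_space S_ob A"
    by (metis homeomorphic_space)
  show "Hausdorff_space (S_ob A)"
    using Hausdorff_stone_topology homeomorphic_Hausdorff_space[OF hs] by simp
  show "compact_space (S_ob A)"
    using compact_stone_topology homeomorphic_compact_space[OF hs] by simp
  show "zero_dimensional (S_ob A)"
    unfolding zero_dimensional_def openin_topology_base_unique
  proof (intro conjI allI impI; (elim conjE)?)
    fix W p assume W: "openin (S_ob A) W" "p \<in> W"
    then obtain U x where U: "openin (stone_topology A) U" "W = code_point A ` U" and x: "x \<in> U" "p = code_point A x"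
      unfolding openin_S_ob by blast
    obtain a where a: "a \<in> carrier A" "x \<in> basic A a" "basic A a \<subseteq> U"
      using U(1) x(1) by (rule openin_stone_topologyE)
    then have "openin (S_ob A) (code_point A ` basic A a) \<and> closedin (S_ob A) (code_point A ` basic A a)"
      using clopen_S_ob_iff code_point_basic by blast
    with U x a show "\<exists>V. (openin (S_ob A) V \<and> closedin (S_ob A) V) \<and> p \<in> V \<and> V \<subseteq> W"
      by (intro exI[of _ "code_point A ` basic A a"]) auto
  qed
  have "code_point A ` pts A = code ` (\<lambda>x. {a \<in> carrier A. x a}) ` pts A"
    by (simp add: code_point_def image_image)
  then show "small (topspace (S_ob A))"
    unfolding topspace_S_ob by (simp only:) (rule small_image_code[OF small_carrier], auto)
qed

end

section \<open>The algebra of clopen sets\<close>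

locale small_space =
  fixes X :: "'u::set_universe topology"
  assumes small_topspace: "small (topspace X)"
begin

lemma elts_code_clopen: "R \<subseteq> topspace X \<Longrightarrow> elts (code R) = R"
  by (rule elts_code_subset[OF small_topspace])

lemma carrier_CO: "u \<in> carrier (CO X) \<longleftrightarrow> openin X (elts u) \<and> closedin X (elts u)"
proof
  assume "u \<in> carrier (CO X)"
  then obtain U where "openin X U" "closedin X U" "u = code U"
    unfolding CO_def by auto
  then show "openin X (elts u) \<and> closedin X (elts u)"
    by (simp add: elts_code_clopen openin_subset)
next
  assume "openin X (elts u) \<and> closedin X (elts u)"
  \<comment> \<open>The rule \<open>code_elts\<close> would rewrite the goal back to
    \<open>u\<close> before the membership in the image of \<open>code\<close> can be
    recognised.\<close>
  then have "code (elts u) \<in> carrier (CO X)"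
    unfolding CO_def by (auto simp del: code_elts)
  then show "u \<in> carrier (CO X)"
    by simp
qed

lemma elts_CO_subset: "u \<in> carrier (CO X) \<Longrightarrow> elts u \<subseteq> topspace X"
  by (simp add: carrier_CO openin_subset)

lemma elts_CO:
  "\<lbrakk>u \<in> carrier (CO X); v \<in> carrier (CO X)\<rbrakk> \<Longrightarrow> elts (meet (CO X) u v) = elts u \<inter> elts v"
  "\<lbrakk>u \<in> carrier (CO X); v \<in> carrier (CO X)\<rbrakk> \<Longrightarrow> elts (join (CO X) u v) = elts u \<union> elts v"
  "elts (compl (CO X) u) = topspace X - elts u"
  "elts (zero (CO X)) = {}"
  "elts (one (CO X)) = topspace X"
  using elts_CO_subset[of u] elts_CO_subset[of v] by (auto simp: CO_def elts_code_clopen le_infI1)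

lemma CO_closed:
  "\<lbrakk>u \<in> carrier (CO X); v \<in> carrier (CO X)\<rbrakk> \<Longrightarrow> meet (CO X) u v \<in> carrier (CO X)"
  "\<lbrakk>u \<in> carrier (CO X); v \<in> carrier (CO X)\<rbrakk> \<Longrightarrow> join (CO X) u v \<in> carrier (CO X)"
  "u \<in> carrier (CO X) \<Longrightarrow> compl (CO X) u \<in> carrier (CO X)"
  "zero (CO X) \<in> carrier (CO X)"
  "one (CO X) \<in> carrier (CO X)"
  using elts_CO(1,2)[of u v] elts_CO(3-5)
  by (auto simp: carrier_CO)

lemma small_boolean_algebra_CO: "small_boolean_algebra (CO X)"
proof
  show "small (carrier (CO X))"
    unfolding CO_def using openin_subset by (auto intro!: small_image_code[OF small_topspace])
\<comment> \<open>Each Boolean law becomes an identity between subsets of the space once both sides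
  are compared by extension.\<close>
qed (auto intro!: elts_inject simp: CO_closed elts_CO dest: subsetD[OF elts_CO_subset])

lemma hat_in_pts: "x \<in> topspace X \<Longrightarrow> hat X x \<in> pts (CO X)"
  unfolding pts_iff hat_def by (simp add: CO_closed elts_CO)

text \<open>A clopen neighbourhood of \<open>x\<close> inside an open set missing \<open>y\<close>
  is a coordinate at which the evaluations differ. Injectivity makes the inverse inside
  \<open>hat_map\<close> return the intended point.\<close>

lemma inj_on_hat:
  assumes "Hausdorff_space X" "zero_dimensional X"
  shows "inj_on (hat X) (topspace X)"
proof (rule inj_onI, rule ccontr)
  fix x y assume xy: "x \<in> topspace X" "y \<in> topspace X" "hat X x = hat X y" "x \<noteq> y"
  then obtain U V where UV: "openin X U" "x \<in> U" "openin X V" "y \<in> V" "disjnt U V"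
    using assms(1) unfolding Hausdorff_space_def by blast
  then obtain W where W: "openin X W \<and> closedin X W" "x \<in> W" "W \<subseteq> U"
    using assms(2) unfolding zero_dimensional_def openin_topology_base_unique by blast
  then have elts: "elts (code W) = W"
    using elts_code_clopen openin_subset by blast
  then have "hat X x (code W) = hat X y (code W)" "code W \<in> carrier (CO X)"
    using W xy(3) by (simp_all add: carrier_CO)
  then show False
    using W UV elts by (auto simp: hat_def disjnt_def)
qed

text \<open>
  Compactness enters here: the clopen sets on which a homomorphism takes the value 1 have the
  finite intersection property, hence a common point.
\<close>

lemma hats_eq_pts:
  assumes "compact_space X"
  shows "hats X = pts (CO X)"
proof
  show "hats X \<subseteq> pts (CO X)"
    unfolding hats_def using hat_in_pts by blast
  show "pts (CO X) \<subseteq> hats X"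
  proof
    fix z assume z: "z \<in> pts (CO X)"
    define \<U> where "\<U> = {elts u |u. u \<in> carrier (CO X) \<and> z u}"
    have "topspace X \<in> \<U>"
      unfolding \<U>_def using z elts_CO(5) CO_closed(5) pts_iff[of z] by auto
    \<comment> \<open>Intersecting with \<open>topspace X\<close> handles the empty family, whose
      intersection is the whole type; it is then represented by \<open>one (CO X)\<close>.\<close>
    have fin: "\<exists>u\<in>carrier (CO X). z u \<and> \<Inter>\<F> \<inter> topspace X = elts u"
      if "finite \<F>" "\<F> \<subseteq> \<U>" for \<F>
      using that
    proof (induction \<F>)
      case empty
      show ?case
        using z elts_CO(5) CO_closed(5) pts_iff[of z] by auto
    next
      case (insert V \<F>)
      then obtain u where u: "u \<in> carrier (CO X)" "z u" "\<Inter>\<F> \<inter> topspace X = elts u"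
        by auto
      from insert obtain v where v: "v \<in> carrier (CO X)" "z v" "V = elts v"
        unfolding \<U>_def by auto
      have "\<Inter>(insert V \<F>) \<inter> topspace X = elts (meet (CO X) v u)"
        using u v by (auto simp: elts_CO)
      moreover have "z (meet (CO X) v u)"
        using z u v unfolding pts_iff by simp
      ultimately show ?case
        using CO_closed(1)[OF v(1) u(1)] by blast
    qed
    have "\<Inter>\<U> \<noteq> {}"
    proof -
      have "closedin X C" if "C \<in> \<U>" for C
        using that unfolding \<U>_def by (auto simp: carrier_CO)
      moreover have "\<Inter>\<F> \<noteq> {}" if "finite \<F>" "\<F> \<subseteq> \<U>" for \<F>
      proof
        assume "\<Inter>\<F> = {}"
        with fin[OF that] obtain u where u: "z u" "elts u = {}"
          by auto
        then have "u = zero (CO X)"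
          by (simp add: elts_inject elts_CO)
        with u z show False
          by (simp add: pts_iff)
      qed
      ultimately show ?thesis
        using assms unfolding compact_space_fip by simp
    qed
    then obtain p where p: "\<And>U. U \<in> \<U> \<Longrightarrow> p \<in> U"
      by blast
    with \<open>topspace X \<in> \<U>\<close> have pX: "p \<in> topspace X"
      by blast
    have "z u \<longleftrightarrow> p \<in> elts u" if u: "u \<in> carrier (CO X)" for u
    proof
      show "z u \<Longrightarrow> p \<in> elts u"
        using p u unfolding \<U>_def by blast
      \<comment> \<open>The common point gives only one implication; applied to the complement of
        \<open>u\<close> it gives the converse, since \<open>z\<close> respects complements.\<close>
      have "z (compl (CO X) u) \<Longrightarrow> p \<in> elts (compl (CO X) u)"
        using p CO_closed(3)[OF u] unfolding \<U>_def by blast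
      then show "p \<in> elts u \<Longrightarrow> z u"
        using u z by (auto simp: elts_CO pts_iff)
    qed
    then have "z = hat X p"
      using z by (auto simp: hat_def pts_iff fun_eq_iff extensional_def)
    then show "z \<in> hats X"
      using pX unfolding hats_def by blast
  qed
qed

end

section \<open>Homomorphisms and the contravariant constructions\<close>

lemma boolean_homsD:
  assumes "\<phi> \<in> boolean_homs A B"
  shows "\<phi> \<in> extensional (carrier A)"
    and "a \<in> carrier A \<Longrightarrow> \<phi> a \<in> carrier B"
    and "\<lbrakk>a \<in> carrier A; b \<in> carrier A\<rbrakk> \<Longrightarrow> \<phi> (meet A a b) = meet B (\<phi> a) (\<phi> b)"
    and "\<lbrakk>a \<in> carrier A; b \<in> carrier A\<rbrakk> \<Longrightarrow> \<phi> (join A a b) = join B (\<phi> a) (\<phi> b)"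
    and "a \<in> carrier A \<Longrightarrow> \<phi> (compl A a) = compl B (\<phi> a)"
    and "\<phi> (zero A) = zero B" "\<phi> (one A) = one B"
  using assms by (auto simp: boolean_homs_def PiE_def)

context boolean_algebra_on
begin

lemmas closed = meet_closed join_closed compl_closed zero_closed one_closed

lemma id_in_boolean_homs: "(\<lambda>a\<in>carrier A. a) \<in> boolean_homs A A"
  by (simp add: boolean_homs_def closed)

lemma compose_in_boolean_homs:
  assumes "\<phi> \<in> boolean_homs A B" "\<psi> \<in> boolean_homs B C"
  shows "compose (carrier A) \<psi> \<phi> \<in> boolean_homs A C"
  unfolding boolean_homs_def
  by (auto simp: closed compose_def boolean_homsD[OF assms(1)] boolean_homsD[OF assms(2)])

lemma compose_in_pts: "\<lbrakk>\<phi> \<in> boolean_homs A B; y \<in> pts B\<rbrakk> \<Longrightarrow> compose (carrier A) y \<phi> \<in> pts A"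
  unfolding pts_def by (rule compose_in_boolean_homs)

end

lemma precomp_in_PiE:
  assumes "boolean_algebra_on A" "\<phi> \<in> boolean_homs A B"
  shows "precomp A B \<phi> \<in> pts B \<rightarrow>\<^sub>E pts A"
  using assms by (auto simp: precomp_def boolean_algebra_on.compose_in_pts)

lemma precomp_id: "precomp A A (\<lambda>a\<in>carrier A. a) = (\<lambda>x\<in>pts A. x)"
  unfolding precomp_def
  by (rule restrict_ext) (auto simp: pts_iff compose_def fun_eq_iff extensional_def)

lemma precomp_compose:
  assumes "boolean_algebra_on B" "\<phi> \<in> boolean_homs A B" "\<psi> \<in> boolean_homs B C"
  shows "precomp A C (compose (carrier A) \<psi> \<phi>) = compose (pts C) (precomp A B \<phi>) (precomp B C \<psi>)"
  using boolean_algebra_on.compose_in_pts[OF assms(1,3)] boolean_homsD(2)[OF assms(2)]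
  by (auto simp: precomp_def compose_def fun_eq_iff)

text \<open>The underlying function of an arrow in the image of \<open>S_functor\<close>, named
  separately so that its values can be computed on extensions.\<close>

definition S_map :: "'u::set_universe boolalg \<Rightarrow> 'u boolalg \<Rightarrow> ('u \<Rightarrow> 'u) \<Rightarrow> 'u \<Rightarrow> 'u" where
  "S_map A B \<phi> = (\<lambda>p\<in>topspace (S_ob B). code_point A (precomp A B \<phi> (decode B p)))"

lemma (in small_boolean_algebra) elts_S_ob: "p \<in> topspace (S_ob A) \<Longrightarrow> elts p \<subseteq> carrier A"
  by (auto simp: topspace_S_ob elts_code_point[OF small_carrier])

lemma (in small_boolean_algebra) small_space_S_ob: "small_space (S_ob A)"
  by standard (rule S_ob_Stone)

locale boolean_hom = dom: small_boolean_algebra A + cod: small_boolean_algebra B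
  for A B :: "'u::set_universe boolalg" and \<phi> +
  assumes hom: "\<phi> \<in> boolean_homs A B"
begin

lemma S_map_code_point:
  assumes "y \<in> pts B"
  shows "S_map A B \<phi> (code_point B y) = code_point A (compose (carrier A) y \<phi>)"
  using assms by (simp add: S_map_def cod.topspace_S_ob precomp_def decode_code_point cod.small_carrier)

lemma S_map_closed: "p \<in> topspace (S_ob B) \<Longrightarrow> S_map A B \<phi> p \<in> topspace (S_ob A)"
  using S_map_code_point dom.compose_in_pts[OF hom]
  by (auto simp: cod.topspace_S_ob dom.topspace_S_ob)

text \<open>In terms of ultrafilters, precomposition with \<open>\<phi>\<close> is inverse image
  under \<open>\<phi>\<close>. Continuity and functoriality are read off from this formula.\<close>

lemma elts_S_map:
  assumes "p \<in> topspace (S_ob B)"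
  shows "elts (S_map A B \<phi> p) = {a \<in> carrier A. \<phi> a \<in> elts p}"
  using assms boolean_homsD(2)[OF hom] S_map_code_point
  by (auto simp: cod.topspace_S_ob elts_code_point dom.small_carrier cod.small_carrier compose_def)

text \<open>The preimage of the clopen set given by \<open>a\<close> is the clopen set given by
  \<open>\<phi> a\<close>, and clopen sets form a base.\<close>

lemma continuous_S_map: "continuous_map (S_ob B) (S_ob A) (S_map A B \<phi>)"
proof (rule continuous_map_into_topology_base)
  show "openin (S_ob A) = arbitrary union_of (\<lambda>U. openin (S_ob A) U \<and> closedin (S_ob A) U)"
    using dom.S_ob_Stone(3) unfolding zero_dimensional_def .
  fix U assume "openin (S_ob A) U \<and> closedin (S_ob A) U"
  then obtain a where a: "a \<in> carrier A" "U = {p \<in> topspace (S_ob A). a \<in> elts p}"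
    using dom.clopen_S_ob_iff by blast
  have "{p \<in> topspace (S_ob B). S_map A B \<phi> p \<in> U} = {p \<in> topspace (S_ob B). \<phi> a \<in> elts p}"
    using a S_map_closed by (auto simp: elts_S_map)
  then show "openin (S_ob B) {p \<in> topspace (S_ob B). S_map A B \<phi> p \<in> U}"
    using cod.clopen_S_ob_iff boolean_homsD(2)[OF hom a(1)] by metis
qed (rule S_map_closed)

end

locale continuous_small = dom: small_space X + cod: small_space Y
  for X Y :: "'u::set_universe topology" and f +
  assumes continuous: "continuous_map X Y f"
begin

lemma elts_CO_map:
  assumes "u \<in> carrier (CO Y)"
  shows "elts (CO_map X Y f u) = {x \<in> topspace X. f x \<in> elts u}"
  using assms by (simp add: CO_map_def dom.elts_code_clopen)

lemma CO_map_in_boolean_homs: "CO_map X Y f \<in> boolean_homs (CO Y) (CO X)"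
proof -
  \<comment> \<open>Preservation of complements and of the top element depends on \<open>f\<close>
    sending points of \<open>X\<close> to points of \<open>Y\<close>.\<close>
  have fY: "f x \<in> topspace Y" if "x \<in> topspace X" for x
    using that continuous continuous_map_image_subset_topspace by blast
  have closed: "CO_map X Y f u \<in> carrier (CO X)" if "u \<in> carrier (CO Y)" for u
    using that continuous unfolding dom.carrier_CO
    by (simp add: elts_CO_map cod.carrier_CO openin_continuous_map_preimage closedin_continuous_map_preimage)
  have "CO_map X Y f \<in> extensional (carrier (CO Y))"
    by (simp add: CO_map_def)
  with closed fY show ?thesis
    unfolding boolean_homs_def PiE_def
    by (auto intro!: elts_inject simp: elts_CO_map cod.CO_closed dom.CO_closed dom.elts_CO cod.elts_CO)
qed

text \<open>Both sides test whether \<open>f x\<close> lies in a clopen set. The same identity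
  yields the agreement of \<open>hat_map\<close> with \<open>precomp\<close> and the naturality of
  \<open>point_map\<close>.\<close>

lemma compose_hat_CO_map:
  assumes "x \<in> topspace X"
  shows "compose (carrier (CO Y)) (hat X x) (CO_map X Y f) = hat Y (f x)"
  using assms boolean_homsD(2)[OF CO_map_in_boolean_homs]
  by (auto simp: compose_def hat_def elts_CO_map fun_eq_iff)

text \<open>Compactness makes the two domains equal, and injectivity of \<open>hat X\<close>
  recovers the point from its evaluation. This is the arrow part of the equation between
  \<open>Fs_functor\<close> and E T.\<close>

lemma hat_map_eq_precomp:
  assumes "Hausdorff_space X" "zero_dimensional X" "compact_space X"
  shows "hat_map X Y f = precomp (CO Y) (CO X) (CO_map X Y f)"
  unfolding hat_map_def precomp_def dom.hats_eq_pts[OF assms(3), symmetric]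
proof (rule restrict_ext)
  fix z assume "z \<in> hats X"
  then obtain x where x: "x \<in> topspace X" "z = hat X x"
    unfolding hats_def by blast
  then show "hat Y (f (inv_into (topspace X) (hat X) z)) = compose (carrier (CO Y)) z (CO_map X Y f)"
    using dom.inj_on_hat[OF assms(1,2)] by (simp add: compose_hat_CO_map)
qed

end

section \<open>The categories\<close>

lemma arrow_category_sel [simp]:
  "Ob (arrow_category Obs H i c) = Obs"
  "Dom (arrow_category Obs H i c) = src"
  "Cod (arrow_category Obs H i c) = tgt"
  "Idt (arrow_category Obs H i c) X = Arrow X X (i X)"
  "Cmp (arrow_category Obs H i c) k h = Arrow (src h) (tgt k) (c (src h) (tgt k) (mor k) (mor h))"
  by (simp_all add: arrow_category_def)

lemma Ar_arrow_category [simp]: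
  "h \<in> Ar (arrow_category Obs H i c) \<longleftrightarrow> src h \<in> Obs \<and> tgt h \<in> Obs \<and> mor h \<in> H (src h) (tgt h)"
  by (cases h) (auto simp: arrow_category_def)

lemma full_subcategory_sel [simp]:
  "Ob (full_subcategory C S) = S"
  "Dom (full_subcategory C S) = Dom C" "Cod (full_subcategory C S) = Cod C"
  "Idt (full_subcategory C S) = Idt C" "Cmp (full_subcategory C S) = Cmp C"
  "h \<in> Ar (full_subcategory C S) \<longleftrightarrow> h \<in> Ar C \<and> Dom C h \<in> S \<and> Cod C h \<in> S"
  by (simp_all add: full_subcategory_def)

lemma compose_restrict_id_right: "f \<in> extensional S \<Longrightarrow> compose S f (\<lambda>x\<in>S. x) = f"
  by (auto simp: compose_def fun_eq_iff extensional_def)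

lemma compose_restrict_id_left: "f \<in> extensional S \<Longrightarrow> f ` S \<subseteq> R \<Longrightarrow> compose S (\<lambda>x\<in>R. x) f = f"
  by (auto simp: compose_def fun_eq_iff extensional_def)

lemma Ob_Boole [simp]: "A \<in> Ob Boole \<longleftrightarrow> small_boolean_algebra A"
  by (simp add: Boole_def small_boolean_algebra_def small_boolean_algebra_axioms_def)

text \<open>Stated through the locale predicate, so that an arrow can be interpreted
  directly.\<close>

lemma Ar_Boole: "h \<in> Ar Boole \<longleftrightarrow> boolean_hom (src h) (tgt h) (mor h)"
  by (simp add: Boole_def boolean_hom_def boolean_hom_axioms_def small_boolean_algebra_def
      small_boolean_algebra_axioms_def)

lemma Boole_sel [simp]:
  "Dom Boole = src" "Cod Boole = tgt"
  "Idt Boole A = Arrow A A (\<lambda>a\<in>carrier A. a)"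
  "Cmp Boole k h = Arrow (src h) (tgt k) (compose (carrier (src h)) (mor k) (mor h))"
  by (simp_all add: Boole_def)

lemma is_category_Boole: "is_category (Boole :: ('u::set_universe boolalg, 'u boolarr) category)"
  unfolding Boole_def
proof (rule is_category_arrow_category; clarify)
  fix A :: "'u boolalg"
  assume "boolean_algebra_on A"
  then show "(\<lambda>a\<in>carrier A. a) \<in> boolean_homs A A"
    by (rule boolean_algebra_on.id_in_boolean_homs)
next
  fix A B C :: "'u boolalg" and \<phi> \<psi>
  assume "boolean_algebra_on A" "\<phi> \<in> boolean_homs A B" "\<psi> \<in> boolean_homs B C"
  then show "compose (carrier A) \<psi> \<phi> \<in> boolean_homs A C"
    by (rule boolean_algebra_on.compose_in_boolean_homs)
next
  fix A B :: "'u boolalg" and \<phi> assume "\<phi> \<in> boolean_homs A B"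
  note \<phi> = boolean_homsD[OF this]
  show "compose (carrier A) \<phi> (\<lambda>a\<in>carrier A. a) = \<phi>"
    using \<phi>(1) by (rule compose_restrict_id_right)
  show "compose (carrier A) (\<lambda>b\<in>carrier B. b) \<phi> = \<phi>"
    using \<phi>(1,2) by (intro compose_restrict_id_left) auto
next
  fix A B C D :: "'u boolalg" and \<phi> \<psi> \<theta> assume "\<phi> \<in> boolean_homs A B"
  then show "compose (carrier A) \<theta> (compose (carrier A) \<psi> \<phi>) = compose (carrier A) (compose (carrier B) \<theta> \<psi>) \<phi>"
    by (auto simp: compose_def fun_eq_iff boolean_homsD)
qed

lemma is_category_ZHaus: "is_category (ZHaus :: ('u::set_universe topology, 'u toparr) category)"
  unfolding ZHaus_def
proof (rule is_category_arrow_category)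
  fix X Y Z :: "'u topology" and f g
  assume "f \<in> {f \<in> extensional (topspace X). continuous_map X Y f}"
    and "g \<in> {f \<in> extensional (topspace Y). continuous_map Y Z f}"
  then have "continuous_map X Z (g \<circ> f)"
    by (auto intro: continuous_map_compose)
  then have "continuous_map X Z (compose (topspace X) g f)"
    by (rule continuous_map_eq) (simp add: compose_eq)
  then show "compose (topspace X) g f \<in> {f \<in> extensional (topspace X). continuous_map X Z f}"
    by simp
next
  fix X Y :: "'u topology" and f
  assume "f \<in> {f \<in> extensional (topspace X). continuous_map X Y f}"
  then show "compose (topspace X) (\<lambda>y\<in>topspace Y. y) f = f"
    using continuous_map_image_subset_topspace[of X Y f] by (intro compose_restrict_id_left) auto
next
  fix W X Y Z :: "'u topology" and f g h
  assume "f \<in> {f \<in> extensional (topspace W). continuous_map W X f}"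
  then show "compose (topspace W) h (compose (topspace W) g f) = compose (topspace W) (compose (topspace X) h g) f"
    using continuous_map_image_subset_topspace[of W X f] by (auto simp: compose_def fun_eq_iff)
qed (auto simp: compose_restrict_id_right)

definition Stone_space :: "'u::set_universe topology \<Rightarrow> bool" where
  "Stone_space X \<longleftrightarrow> Hausdorff_space X \<and> zero_dimensional X \<and> small_space X \<and> compact_space X"

lemma Ob_Stone [simp]: "X \<in> Ob Stone \<longleftrightarrow> Stone_space X"
  by (auto simp: Stone_def ZHaus_def Stone_space_def small_space_def)

lemma Ar_Stone: "h \<in> Ar Stone \<longleftrightarrow> Stone_space (src h) \<and> Stone_space (tgt h) \<and>
    mor h \<in> extensional (topspace (src h)) \<and> continuous_map (src h) (tgt h) (mor h)"
  by (auto simp: Stone_def ZHaus_def Stone_space_def small_space_def)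

lemma Ar_StoneD: "h \<in> Ar Stone \<Longrightarrow> continuous_small (src h) (tgt h) (mor h)"
  by (simp add: Ar_Stone continuous_small_def continuous_small_axioms_def Stone_space_def)

lemma Stone_sel [simp]:
  "Dom Stone = src" "Cod Stone = tgt"
  "Idt Stone X = Arrow X X (\<lambda>x\<in>topspace X. x)"
  "Cmp Stone k h = Arrow (src h) (tgt k) (compose (topspace (src h)) (mor k) (mor h))"
  by (simp_all add: Stone_def ZHaus_def)

lemma is_category_Stone: "is_category Stone"
  unfolding Stone_def by (rule is_category_full_subcategory[OF is_category_ZHaus]) auto

lemma Stone_subset_ZHaus: "Ob Stone \<subseteq> Ob ZHaus" "Ar Stone \<subseteq> Ar ZHaus"
  by (auto simp: Stone_def)

section \<open>Dz-algebras and compact dz-algebras\<close>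

lemma dz_homs_iff:
  "m \<in> dz_homs P Q \<longleftrightarrow> fst m \<in> boolean_homs (fst P) (fst Q) \<and> snd m \<in> snd Q \<rightarrow>\<^sub>E snd P \<and>
     (\<forall>x\<in>snd Q. compose (carrier (fst P)) x (fst m) = snd m x)"
  by (simp add: dz_homs_def split_beta)

lemma dz_algebraD:
  "dz_algebra P \<Longrightarrow> boolean_algebra_on (fst P)" "dz_algebra P \<Longrightarrow> snd P \<subseteq> pts (fst P)"
  by (auto simp: dz_algebra_def z_algebra_def split_beta)

lemma is_category_dzBoole: "is_category (dzBoole :: ('u::set_universe zalg, 'u zarr) category)"
  unfolding dzBoole_def
proof (rule is_category_arrow_category; (clarsimp simp: dz_homs_iff)?)
  fix A :: "'u boolalg" and X
  assume "dz_algebra (A, X)"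
  note A = dz_algebraD[OF this, simplified]
  show "(\<lambda>a\<in>carrier A. a) \<in> boolean_homs A A \<and> (\<forall>x\<in>X. compose (carrier A) x (\<lambda>a\<in>carrier A. a) = x)"
    using A boolean_algebra_on.id_in_boolean_homs[OF A(1)]
    by (auto intro!: compose_restrict_id_right simp: pts_iff)
next
  fix A B C :: "'u boolalg" and X Y Z \<phi> f \<psi> g
  assume "dz_algebra (A, X)"
    and \<phi>: "\<phi> \<in> boolean_homs A B" and f: "f \<in> Y \<rightarrow>\<^sub>E X" "\<forall>y\<in>Y. compose (carrier A) y \<phi> = f y"
    and \<psi>: "\<psi> \<in> boolean_homs B C" and g: "g \<in> Z \<rightarrow>\<^sub>E Y" "\<forall>z\<in>Z. compose (carrier B) z \<psi> = g z"
  note A = dz_algebraD(1)[OF this(1), simplified]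
  have "compose (carrier A) z (compose (carrier A) \<psi> \<phi>) = f (g z)" if z: "z \<in> Z" for z
  proof -
    have "compose (carrier A) z (compose (carrier A) \<psi> \<phi>) = compose (carrier A) (compose (carrier B) z \<psi>) \<phi>"
      using boolean_homsD(2)[OF \<phi>] by (auto simp: compose_def fun_eq_iff)
    also have "\<dots> = f (g z)"
      using f g z by auto
    finally show ?thesis .
  qed
  moreover have "compose Z f g \<in> Z \<rightarrow>\<^sub>E X"
    using f g by (auto simp: compose_def)
  ultimately show "compose (carrier A) \<psi> \<phi> \<in> boolean_homs A C \<and> compose Z f g \<in> Z \<rightarrow>\<^sub>E X \<and>
      (\<forall>z\<in>Z. compose (carrier A) z (compose (carrier A) \<psi> \<phi>) = compose Z f g z)"
    using boolean_algebra_on.compose_in_boolean_homs[OF A \<phi> \<psi>] by (simp add: compose_eq)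
next
  fix A B :: "'u boolalg" and X Y \<phi> f
  assume "\<phi> \<in> boolean_homs A B" and f: "f \<in> Y \<rightarrow>\<^sub>E X"
  note \<phi> = boolean_homsD[OF this(1)]
  show "compose (carrier A) \<phi> (\<lambda>a\<in>carrier A. a) = \<phi> \<and> compose Y (\<lambda>x\<in>X. x) f = f"
    using \<phi>(1) f by (auto intro!: compose_restrict_id_right compose_restrict_id_left simp: PiE_def)
  show "compose (carrier A) (\<lambda>b\<in>carrier B. b) \<phi> = \<phi> \<and> compose Y f (\<lambda>y\<in>Y. y) = f"
    using \<phi>(1,2) f by (auto intro!: compose_restrict_id_right compose_restrict_id_left simp: PiE_def)
next
  fix A B C :: "'u boolalg" and W X Y Z \<phi> f \<psi> g \<theta> h
  assume "\<phi> \<in> boolean_homs A B" "h \<in> Z \<rightarrow>\<^sub>E Y"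
  then show "compose (carrier A) \<theta> (compose (carrier A) \<psi> \<phi>) = compose (carrier A) (compose (carrier B) \<theta> \<psi>) \<phi> \<and>
      compose Z (compose Y f g) h = compose Z f (compose Z g h)"
    by (auto simp: compose_def fun_eq_iff boolean_homsD)
qed

lemma Ob_kBoole: "P \<in> Ob kBoole \<longleftrightarrow> (\<exists>A. small_boolean_algebra A \<and> P = (A, pts A))"
  by (auto simp: kBoole_def)

lemma kBoole_subset: "{(A, pts A) |A. A \<in> Ob Boole} \<subseteq> Ob dzBoole"
proof -
  have "dz_algebra (A, pts A)" "small (carrier A)" if "small_boolean_algebra A" for A :: "'u::set_universe boolalg"
    using that boolean_algebra_on.dz_algebra_pts[of A]
    by (simp_all add: small_boolean_algebra_def small_boolean_algebra_axioms_def)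
  then show ?thesis
    by (auto simp: dzBoole_def)
qed

lemma is_category_kBoole: "is_category kBoole"
  unfolding kBoole_def by (rule is_category_full_subcategory[OF is_category_dzBoole kBoole_subset])

lemma kBoole_sel [simp]:
  "Dom kBoole = src" "Cod kBoole = tgt"
  "Idt kBoole P = Arrow P P (\<lambda>a\<in>carrier (fst P). a, \<lambda>x\<in>snd P. x)"
  "Cmp kBoole k h = Arrow (src h) (tgt k)
     (compose (carrier (fst (src h))) (fst (mor k)) (fst (mor h)),
      compose (snd (tgt k)) (snd (mor h)) (snd (mor k)))"
  by (simp_all add: kBoole_def dzBoole_def)

text \<open>The compatibility condition fixes the second component at every point of the target
  algebra, and extensionality fixes it elsewhere; so an arrow is determined by its homomorphism.
  This is why E is bijective on arrows.\<close>

lemma Ar_kBoole: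
  "h \<in> Ar kBoole \<longleftrightarrow> (\<exists>A B \<phi>. boolean_hom A B \<phi> \<and> h = Arrow (A, pts A) (B, pts B) (\<phi>, precomp A B \<phi>))"
proof
  assume "h \<in> Ar kBoole"
  then obtain A B \<phi> f where AB: "small_boolean_algebra A" "small_boolean_algebra B"
    and h: "h = Arrow (A, pts A) (B, pts B) (\<phi>, f)" and m: "(\<phi>, f) \<in> dz_homs (A, pts A) (B, pts B)"
    by (cases h) (auto simp: kBoole_def dzBoole_def)
  have f: "f = precomp A B \<phi>"
    using m unfolding dz_homs_iff precomp_def by (auto simp: fun_eq_iff PiE_def extensional_def)
  have "boolean_hom A B \<phi>"
    using AB m by (simp add: boolean_hom_def boolean_hom_axioms_def dz_homs_iff)
  with h f show "\<exists>A B \<phi>. boolean_hom A B \<phi> \<and> h = Arrow (A, pts A) (B, pts B) (\<phi>, precomp A B \<phi>)"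
    by blast
next
  assume "\<exists>A B \<phi>. boolean_hom A B \<phi> \<and> h = Arrow (A, pts A) (B, pts B) (\<phi>, precomp A B \<phi>)"
  then obtain A B \<phi> where "boolean_hom A B \<phi>" and h: "h = Arrow (A, pts A) (B, pts B) (\<phi>, precomp A B \<phi>)"
    by blast
  then interpret boolean_hom A B \<phi> by simp
  have "(A, pts A) \<in> Ob dzBoole" "(B, pts B) \<in> Ob dzBoole"
    using kBoole_subset dom.small_boolean_algebra_axioms cod.small_boolean_algebra_axioms by auto
  moreover have "(\<phi>, precomp A B \<phi>) \<in> dz_homs (A, pts A) (B, pts B)"
    using hom precomp_in_PiE[OF dom.boolean_algebra_on_axioms hom]
    by (auto simp: dz_homs_iff precomp_def)
  ultimately show "h \<in> Ar kBoole"
    using dom.small_boolean_algebra_axioms cod.small_boolean_algebra_axioms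
    by (simp add: h kBoole_def) (simp add: dzBoole_def)
qed

section \<open>The functors\<close>

lemma covariant_E: "covariant (E_functor :: ('u::set_universe boolalg, 'u boolarr, 'u zalg, 'u zarr) functor_data)"
  unfolding E_functor_def
proof (rule covariant_mk_functorI[OF is_category_Boole is_category_kBoole])
  fix h k :: "'u boolarr" assume hk: "h \<in> Ar Boole" "k \<in> Ar Boole" "Cod Boole h = Dom Boole k"
  interpret h: boolean_hom "src h" "tgt h" "mor h"
    using hk Ar_Boole by blast
  interpret k: boolean_hom "src k" "tgt k" "mor k"
    using hk Ar_Boole by blast
  show "Arrow (src (Cmp Boole k h), pts (src (Cmp Boole k h))) (tgt (Cmp Boole k h), pts (tgt (Cmp Boole k h)))
      (mor (Cmp Boole k h), precomp (src (Cmp Boole k h)) (tgt (Cmp Boole k h)) (mor (Cmp Boole k h))) =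
    Cmp kBoole (Arrow (src k, pts (src k)) (tgt k, pts (tgt k)) (mor k, precomp (src k) (tgt k) (mor k)))
      (Arrow (src h, pts (src h)) (tgt h, pts (tgt h)) (mor h, precomp (src h) (tgt h) (mor h)))"
    using precomp_compose[OF h.cod.boolean_algebra_on_axioms h.hom] k.hom hk(3) by simp
qed (auto simp: Ar_Boole Ar_kBoole Ob_kBoole precomp_id)

lemma covariant_Einv: "covariant Einv_functor"
  unfolding Einv_functor_def
  by (rule covariant_mk_functorI[OF is_category_kBoole is_category_Boole])
    (auto simp: Ar_Boole Ar_kBoole Ob_kBoole)

lemma E_functor_sel [simp]:
  "Src E_functor = Boole" "Tgt E_functor = kBoole"
  "small_boolean_algebra A \<Longrightarrow> fob E_functor A = (A, pts A)"
  "h \<in> Ar Boole \<Longrightarrow> far E_functor h =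
     Arrow (src h, pts (src h)) (tgt h, pts (tgt h)) (mor h, precomp (src h) (tgt h) (mor h))"
  by (simp_all add: E_functor_def)

lemma Einv_functor_sel [simp]:
  "Src Einv_functor = kBoole" "Tgt Einv_functor = Boole"
  "P \<in> Ob kBoole \<Longrightarrow> fob Einv_functor P = fst P"
  "h \<in> Ar kBoole \<Longrightarrow> far Einv_functor h = Arrow (fst (src h)) (fst (tgt h)) (fst (mor h))"
  by (simp_all add: Einv_functor_def)

lemma Einv_E: "Einv_functor \<circ>\<^sub>F E_functor = id_functor (Boole :: ('u::set_universe boolalg, 'u boolarr) category)"
  unfolding comp_functor_def id_functor_def
proof (rule mk_functor_cong)
  fix A :: "'u boolalg" assume "A \<in> Ob Boole"
  then show "(fob Einv_functor \<circ> fob E_functor) A = A"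
    using covariantD(3)[OF covariant_E, of A] by simp
next
  fix h :: "'u boolarr" assume "h \<in> Ar Boole"
  then show "(far Einv_functor \<circ> far E_functor) h = h"
    using covariantD(4)[OF covariant_E, of h] by simp
qed simp_all

lemma E_Einv: "E_functor \<circ>\<^sub>F Einv_functor = id_functor (kBoole :: ('u::set_universe zalg, 'u zarr) category)"
  unfolding comp_functor_def id_functor_def
proof (rule mk_functor_cong)
  fix P :: "'u zalg" assume P: "P \<in> Ob kBoole"
  then have "(fob E_functor \<circ> fob Einv_functor) P = (fst P, pts (fst P))"
    using covariantD(3)[OF covariant_Einv, of P] by simp
  with P show "(fob E_functor \<circ> fob Einv_functor) P = P"
    by (auto simp: Ob_kBoole)
next
  fix h :: "'u zarr" assume h: "h \<in> Ar kBoole"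
  then have "(far E_functor \<circ> far Einv_functor) h = Arrow (fst (src h), pts (fst (src h)))
      (fst (tgt h), pts (fst (tgt h))) (fst (mor h), precomp (fst (src h)) (fst (tgt h)) (fst (mor h)))"
    using covariantD(4)[OF covariant_Einv, of h] by simp
  with h show "(far E_functor \<circ> far Einv_functor) h = h"
    by (auto simp: Ar_kBoole)
qed simp_all

section \<open>Functoriality of clopen algebras and Stone spaces\<close>

lemma T_functor_eq:
  "T_functor = mk_functor Stone Boole CO (\<lambda>h. Arrow (CO (tgt h)) (CO (src h)) (CO_map (src h) (tgt h) (mor h)))"
  unfolding T_functor_def restrict_functor_def CO_functor_def
  using Stone_subset_ZHaus by (intro mk_functor_cong) (auto dest: subsetD)

lemma S_functor_eq:
  "S_functor = mk_functor Boole Stone S_ob (\<lambda>h. Arrow (S_ob (tgt h)) (S_ob (src h)) (S_map (src h) (tgt h) (mor h)))"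
  by (simp add: S_functor_def S_map_def)

lemma (in small_boolean_algebra) Stone_space_S_ob: "Stone_space (S_ob A)"
  by (simp add: Stone_space_def S_ob_Stone small_space_S_ob)

lemma boolean_hom_id: "small_boolean_algebra A \<Longrightarrow> boolean_hom A A (\<lambda>a\<in>carrier A. a)"
  by (simp add: boolean_hom_def boolean_hom_axioms_def small_boolean_algebra_def boolean_algebra_on.id_in_boolean_homs)

lemma contravariant_S: "contravariant (S_functor :: ('u::set_universe boolalg, 'u boolarr, 'u topology, 'u toparr) functor_data)"
  unfolding S_functor_eq
proof (rule contravariant_mk_functorI[OF is_category_Boole is_category_Stone])
  fix A :: "'u boolalg" assume "A \<in> Ob Boole"
  then interpret small_boolean_algebra A by simp
  show "S_ob A \<in> Ob Stone"
    by (simp add: Stone_space_S_ob)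
  interpret boolean_hom A A "\<lambda>a\<in>carrier A. a"
    by (rule boolean_hom_id) (rule small_boolean_algebra_axioms)
  \<comment> \<open>The formula for the extension returns only elements of the carrier;
    \<open>elts_S_ob\<close> ensures that nothing of \<open>p\<close> is lost.\<close>
  have "S_map A A (\<lambda>a\<in>carrier A. a) p = p" if "p \<in> topspace (S_ob A)" for p
    using that elts_S_ob[OF that] by (intro elts_inject) (auto simp: elts_S_map)
  moreover have "S_map A A (\<lambda>a\<in>carrier A. a) \<in> extensional (topspace (S_ob A))"
    by (simp add: S_map_def)
  ultimately have "S_map A A (\<lambda>a\<in>carrier A. a) = (\<lambda>p\<in>topspace (S_ob A). p)"
    by (auto intro: extensionalityI)
  then show "Arrow (S_ob (tgt (Idt Boole A))) (S_ob (src (Idt Boole A)))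
      (S_map (src (Idt Boole A)) (tgt (Idt Boole A)) (mor (Idt Boole A))) = Idt Stone (S_ob A)"
    by simp
next
  fix h :: "'u boolarr" assume "h \<in> Ar Boole"
  then interpret h: boolean_hom "src h" "tgt h" "mor h"
    using Ar_Boole by blast
  show "Arrow (S_ob (tgt h)) (S_ob (src h)) (S_map (src h) (tgt h) (mor h)) \<in> Ar Stone \<and>
      Dom Stone (Arrow (S_ob (tgt h)) (S_ob (src h)) (S_map (src h) (tgt h) (mor h))) = S_ob (Cod Boole h) \<and>
      Cod Stone (Arrow (S_ob (tgt h)) (S_ob (src h)) (S_map (src h) (tgt h) (mor h))) = S_ob (Dom Boole h)"
    using h.continuous_S_map h.dom.Stone_space_S_ob h.cod.Stone_space_S_ob
    by (simp add: Ar_Stone) (simp add: S_map_def)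
next
  fix h k :: "'u boolarr" assume hk: "h \<in> Ar Boole" "k \<in> Ar Boole" "Cod Boole h = Dom Boole k"
  interpret h: boolean_hom "src h" "tgt h" "mor h"
    using hk Ar_Boole by blast
  interpret k: boolean_hom "tgt h" "tgt k" "mor k"
    using hk Ar_Boole by (metis Boole_sel(1,2))
  let ?m = "compose (carrier (src h)) (mor k) (mor h)"
  interpret kh: boolean_hom "src h" "tgt k" ?m
    by standard (rule h.dom.compose_in_boolean_homs[OF h.hom k.hom])
  have "S_map (src h) (tgt k) ?m p = S_map (src h) (tgt h) (mor h) (S_map (tgt h) (tgt k) (mor k) p)"
    if "p \<in> topspace (S_ob (tgt k))" for p
    using that k.S_map_closed[OF that] boolean_homsD(2)[OF h.hom]
    by (intro elts_inject) (auto simp: kh.elts_S_map h.elts_S_map k.elts_S_map compose_eq)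
  then have "S_map (src h) (tgt k) ?m =
      compose (topspace (S_ob (tgt k))) (S_map (src h) (tgt h) (mor h)) (S_map (tgt h) (tgt k) (mor k))"
    by (intro extensionalityI[of _ "topspace (S_ob (tgt k))"]) (simp_all add: compose_eq, simp add: S_map_def)
  then show "Arrow (S_ob (tgt (Cmp Boole k h))) (S_ob (src (Cmp Boole k h)))
      (S_map (src (Cmp Boole k h)) (tgt (Cmp Boole k h)) (mor (Cmp Boole k h))) =
    Cmp Stone (Arrow (S_ob (tgt h)) (S_ob (src h)) (S_map (src h) (tgt h) (mor h)))
      (Arrow (S_ob (tgt k)) (S_ob (src k)) (S_map (src k) (tgt k) (mor k)))"
    using hk(3) by simp
qed

lemma contravariant_T: "contravariant (T_functor :: ('u::set_universe topology, 'u toparr, 'u boolalg, 'u boolarr) functor_data)"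
  unfolding T_functor_eq
proof (rule contravariant_mk_functorI[OF is_category_Stone is_category_Boole])
  fix X :: "'u topology" assume "X \<in> Ob Stone"
  then interpret small_space X by (simp add: Stone_space_def)
  show "CO X \<in> Ob Boole"
    by (simp add: small_boolean_algebra_CO)
  have "CO_map X X (\<lambda>x\<in>topspace X. x) = (\<lambda>u\<in>carrier (CO X). u)"
    unfolding CO_map_def
  proof (rule restrict_ext)
    fix u assume u: "u \<in> carrier (CO X)"
    then have "{x \<in> topspace X. restrict (\<lambda>x. x) (topspace X) x \<in> elts u} = elts u"
      using elts_CO_subset[OF u] by auto
    then show "code {x \<in> topspace X. restrict (\<lambda>x. x) (topspace X) x \<in> elts u} = u"
      by simp
  qed
  then show "Arrow (CO (tgt (Idt Stone X))) (CO (src (Idt Stone X)))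
      (CO_map (src (Idt Stone X)) (tgt (Idt Stone X)) (mor (Idt Stone X))) = Idt Boole (CO X)"
    by simp
next
  fix h :: "'u toparr" assume "h \<in> Ar Stone"
  then interpret h: continuous_small "src h" "tgt h" "mor h"
    by (rule Ar_StoneD)
  show "Arrow (CO (tgt h)) (CO (src h)) (CO_map (src h) (tgt h) (mor h)) \<in> Ar Boole \<and>
      Dom Boole (Arrow (CO (tgt h)) (CO (src h)) (CO_map (src h) (tgt h) (mor h))) = CO (Cod Stone h) \<and>
      Cod Boole (Arrow (CO (tgt h)) (CO (src h)) (CO_map (src h) (tgt h) (mor h))) = CO (Dom Stone h)"
    using h.CO_map_in_boolean_homs h.dom.small_boolean_algebra_CO h.cod.small_boolean_algebra_CO
    by (simp add: Ar_Boole boolean_hom_def boolean_hom_axioms_def)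
next
  fix h k :: "'u toparr" assume hk: "h \<in> Ar Stone" "k \<in> Ar Stone" "Cod Stone h = Dom Stone k"
  interpret h: continuous_small "src h" "tgt h" "mor h"
    using hk(1) by (rule Ar_StoneD)
  interpret k: continuous_small "tgt h" "tgt k" "mor k"
    using Ar_StoneD[OF hk(2)] hk(3) by simp
  let ?m = "compose (topspace (src h)) (mor k) (mor h)"
  have "CO_map (src h) (tgt k) ?m u = CO_map (src h) (tgt h) (mor h) (CO_map (tgt h) (tgt k) (mor k) u)"
    if u: "u \<in> carrier (CO (tgt k))" for u
  proof -
    have "mor h x \<in> topspace (tgt h)" if "x \<in> topspace (src h)" for x
      using that h.continuous continuous_map_image_subset_topspace by blast
    then have "{x \<in> topspace (src h). ?m x \<in> elts u} =
        {x \<in> topspace (src h). mor h x \<in> elts (CO_map (tgt h) (tgt k) (mor k) u)}"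
      using u by (auto simp: k.elts_CO_map compose_eq)
    then show ?thesis
      using u boolean_homsD(2)[OF k.CO_map_in_boolean_homs u] by (simp add: CO_map_def)
  qed
  then have "CO_map (src h) (tgt k) ?m =
      compose (carrier (CO (tgt k))) (CO_map (src h) (tgt h) (mor h)) (CO_map (tgt h) (tgt k) (mor k))"
    by (intro extensionalityI[of _ "carrier (CO (tgt k))"]) (simp_all add: compose_eq, simp add: CO_map_def)
  then show "Arrow (CO (tgt (Cmp Stone k h))) (CO (src (Cmp Stone k h)))
      (CO_map (src (Cmp Stone k h)) (tgt (Cmp Stone k h)) (mor (Cmp Stone k h))) =
    Cmp Boole (Arrow (CO (tgt h)) (CO (src h)) (CO_map (src h) (tgt h) (mor h)))
      (Arrow (CO (tgt k)) (CO (src k)) (CO_map (src k) (tgt k) (mor k)))"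
    using hk(3) by simp
qed

section \<open>The dual equivalence of Boolean algebras and Stone spaces\<close>

text \<open>The inverse of a bijective homomorphism preserves each operation: apply the operation to
  the inverse images and use injectivity.\<close>

lemma isomorphism_Boole:
  assumes "boolean_hom A B \<phi>" and bij: "bij_betw \<phi> (carrier A) (carrier B)"
  shows "isomorphism Boole (Arrow A B \<phi>)"
proof -
  interpret boolean_hom A B \<phi> by fact
  define \<psi> where "\<psi> = (\<lambda>b\<in>carrier B. inv_into (carrier A) \<phi> b)"
  note \<phi> = boolean_homsD[OF hom]
  have \<psi>\<phi>: "\<psi> (\<phi> a) = a" if "a \<in> carrier A" for a
    using that bij \<phi>(2) by (simp add: \<psi>_def bij_betw_def)
  have \<psi>: "\<psi> b \<in> carrier A \<and> \<phi> (\<psi> b) = b" if "b \<in> carrier B" for b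
  proof -
    have "b \<in> \<phi> ` carrier A"
      using that bij by (simp add: bij_betw_def)
    then obtain a where "a \<in> carrier A" "b = \<phi> a"
      by blast
    then show ?thesis
      by (simp add: \<psi>\<phi>)
  qed
  have "\<psi> \<in> boolean_homs B A"
  proof -
    have "\<psi> (meet B b c) = meet A (\<psi> b) (\<psi> c)" "\<psi> (join B b c) = join A (\<psi> b) (\<psi> c)"
      if "b \<in> carrier B" "c \<in> carrier B" for b c
      using \<psi>[OF that(1)] \<psi>[OF that(2)] \<psi>\<phi>[of "meet A (\<psi> b) (\<psi> c)"] \<psi>\<phi>[of "join A (\<psi> b) (\<psi> c)"]
      by (simp_all add: \<phi> dom.closed)
    moreover have "\<psi> (compl B b) = compl A (\<psi> b)" if "b \<in> carrier B" for b
      using \<psi>[OF that] \<psi>\<phi>[of "compl A (\<psi> b)"] by (simp add: \<phi> dom.closed)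
    moreover have "\<psi> (zero B) = zero A" "\<psi> (one B) = one A"
      using \<psi>\<phi>[of "zero A"] \<psi>\<phi>[of "one A"] by (simp_all add: \<phi> dom.closed)
    ultimately show ?thesis
      using \<psi> by (simp add: boolean_homs_def PiE_def) (simp add: \<psi>_def)
  qed
  then have "Arrow B A \<psi> \<in> Ar Boole" "Arrow A B \<phi> \<in> Ar Boole"
    using dom.small_boolean_algebra_axioms cod.small_boolean_algebra_axioms hom
    by (simp_all add: Ar_Boole boolean_hom_def boolean_hom_axioms_def)
  moreover have "compose (carrier A) \<psi> \<phi> = (\<lambda>a\<in>carrier A. a)" "compose (carrier B) \<phi> \<psi> = (\<lambda>b\<in>carrier B. b)"
    using \<psi> \<psi>\<phi> by (auto simp: compose_def)
  ultimately show ?thesis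
    unfolding isomorphism_def by (intro conjI bexI[of _ "Arrow B A \<psi>"]) simp_all
qed

lemma isomorphism_Stone:
  assumes "Stone_space X" "Stone_space Y" "f \<in> extensional (topspace X)" "homeomorphic_map X Y f"
  shows "isomorphism Stone (Arrow X Y f)"
proof -
  obtain g where g: "homeomorphic_maps X Y f g"
    using assms(4) by (auto simp: homeomorphic_map_maps)
  \<comment> \<open>The inverse is arbitrary off \<open>topspace Y\<close>; restricting it makes it
    extensional, as arrows of \<open>Stone\<close> are.\<close>
  have "continuous_map Y X (restrict g (topspace Y))"
    using g by (simp add: homeomorphic_maps_def)
  then have "Arrow X Y f \<in> Ar Stone" "Arrow Y X (restrict g (topspace Y)) \<in> Ar Stone"
    using assms g by (simp_all add: Ar_Stone homeomorphic_maps_def)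
  moreover have "compose (topspace X) (restrict g (topspace Y)) f = (\<lambda>x\<in>topspace X. x)"
    "compose (topspace Y) f (restrict g (topspace Y)) = (\<lambda>y\<in>topspace Y. y)"
    using g continuous_map_image_subset_topspace[of X Y f] unfolding homeomorphic_maps_def compose_def
    by (auto intro!: restrict_ext)
  ultimately show ?thesis
    unfolding isomorphism_def by (intro conjI bexI[of _ "Arrow Y X (restrict g (topspace Y))"]) simp_all
qed

text \<open>The unit from \<open>X\<close> to the Stone space of its clopen algebra: a point goes to
  the coded ultrafilter of its clopen neighbourhoods.\<close>

definition point_map :: "'u::set_universe topology \<Rightarrow> 'u \<Rightarrow> 'u" where
  "point_map X = (\<lambda>x\<in>topspace X. code_point (CO X) (hat X x))"

lemma (in small_space) elts_point_map:
  "x \<in> topspace X \<Longrightarrow> elts (point_map X x) = {u \<in> carrier (CO X). x \<in> elts u}"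
  using small_boolean_algebra.small_carrier[OF small_boolean_algebra_CO]
  by (auto simp: point_map_def elts_code_point hat_def)

text \<open>A continuous bijection from a compact space onto a Hausdorff space is a homeomorphism.
  Surjectivity is \<open>hats_eq_pts\<close>, injectivity is \<open>inj_on_hat\<close>, and the
  clopen set given by \<open>u\<close> pulls back to \<open>elts u\<close>.\<close>

lemma homeomorphic_point_map:
  assumes "Stone_space X"
  shows "homeomorphic_map X (S_ob (CO X)) (point_map X)"
proof -
  interpret small_space X
    using assms by (simp add: Stone_space_def)
  interpret CO: small_boolean_algebra "CO X"
    by (rule small_boolean_algebra_CO)
  have X: "Hausdorff_space X" "zero_dimensional X" "compact_space X"
    using assms by (simp_all add: Stone_space_def)
  have image: "point_map X ` topspace X = topspace (S_ob (CO X))"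
    unfolding CO.topspace_S_ob hats_eq_pts[OF X(3), symmetric] hats_def by (auto simp: point_map_def)
  show ?thesis
  proof (rule continuous_imp_homeomorphic_map[OF _ X(3) CO.S_ob_Stone(1) image])
    show "inj_on (point_map X) (topspace X)"
    proof (rule inj_onI)
      fix x y assume xy: "x \<in> topspace X" "y \<in> topspace X" "point_map X x = point_map X y"
      then have "{u \<in> carrier (CO X). x \<in> elts u} = {u \<in> carrier (CO X). y \<in> elts u}"
        by (metis elts_point_map)
      then have "hat X x = hat X y"
        by (auto simp: hat_def fun_eq_iff)
      with xy show "x = y"
        using inj_on_hat[OF X(1,2)] by (simp add: inj_on_eq_iff)
    qed
    show "continuous_map X (S_ob (CO X)) (point_map X)"
    proof (rule continuous_map_into_topology_base)
      show "openin (S_ob (CO X)) = arbitrary union_of (\<lambda>U. openin (S_ob (CO X)) U \<and> closedin (S_ob (CO X)) U)"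
        using CO.S_ob_Stone(3) unfolding zero_dimensional_def .
      fix U assume "openin (S_ob (CO X)) U \<and> closedin (S_ob (CO X)) U"
      then obtain u where u: "u \<in> carrier (CO X)" "U = {p \<in> topspace (S_ob (CO X)). u \<in> elts p}"
        using CO.clopen_S_ob_iff by blast
      have "point_map X x \<in> U \<longleftrightarrow> x \<in> elts u" if x: "x \<in> topspace X" for x
        using x u imageI[OF x, of "point_map X"] unfolding image by (simp add: elts_point_map)
      then have "{x \<in> topspace X. point_map X x \<in> U} = elts u"
        using elts_CO_subset[OF u(1)] by blast
      then show "openin X {x \<in> topspace X. point_map X x \<in> U}"
        using u(1) by (simp add: carrier_CO)
    qed (use image in blast)
  qed
qed

lemma T_functor_sel [simp]:
  "Src T_functor = Stone" "Tgt T_functor = Boole"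
  "Stone_space X \<Longrightarrow> fob T_functor X = CO X"
  "h \<in> Ar Stone \<Longrightarrow> far T_functor h = Arrow (CO (tgt h)) (CO (src h)) (CO_map (src h) (tgt h) (mor h))"
  by (simp_all add: T_functor_eq)

lemma S_functor_sel [simp]:
  "Src S_functor = Boole" "Tgt S_functor = Stone"
  "small_boolean_algebra A \<Longrightarrow> fob S_functor A = S_ob A"
  "h \<in> Ar Boole \<Longrightarrow> far S_functor h = Arrow (S_ob (tgt h)) (S_ob (src h)) (S_map (src h) (tgt h) (mor h))"
  by (simp_all add: S_functor_eq)

lemma ST_iso_id:
  "naturally_isomorphic (S_functor \<circ>\<^sub>F T_functor) (id_functor (Stone :: ('u::set_universe topology, 'u toparr) category))"
proof (rule naturally_isomorphic_sym)
  let ?S = "S_functor :: ('u boolalg, 'u boolarr, 'u topology, 'u toparr) functor_data"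
  let ?T = "T_functor :: ('u topology, 'u toparr, 'u boolalg, 'u boolarr) functor_data"
  let ?\<eta> = "\<lambda>X :: 'u topology. Arrow X (S_ob (CO X)) (point_map X)"
  have CO: "small_boolean_algebra (CO X)" if "Stone_space X" for X :: "'u topology"
    using that by (simp add: Stone_space_def small_space.small_boolean_algebra_CO)
  have iso: "isomorphism Stone (?\<eta> X)" if X: "Stone_space X" for X
    using X small_boolean_algebra.Stone_space_S_ob[OF CO[OF X]] homeomorphic_point_map[OF X]
    by (intro isomorphism_Stone) (simp_all add: point_map_def)
  have nat: "Cmp Stone (?\<eta> (tgt h)) h = Cmp Stone (far ?S (far ?T h)) (?\<eta> (src h))"
    if h: "h \<in> Ar Stone" for h :: "'u toparr"
  proof -
    interpret continuous_small "src h" "tgt h" "mor h"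
      using h by (rule Ar_StoneD)
    have Th: "far ?T h \<in> Ar Boole"
      using contravariantD(4)[OF contravariant_T, of h] h by simp
    then interpret T: boolean_hom "CO (tgt h)" "CO (src h)" "CO_map (src h) (tgt h) (mor h)"
      using h by (simp add: Ar_Boole)
    have "compose (topspace (src h)) (point_map (tgt h)) (mor h) =
      compose (topspace (src h)) (S_map (CO (tgt h)) (CO (src h)) (CO_map (src h) (tgt h) (mor h))) (point_map (src h))"
    proof (rule extensionalityI[of _ "topspace (src h)"])
      fix x assume x: "x \<in> topspace (src h)"
      then have y: "mor h x \<in> topspace (tgt h)"
        using continuous continuous_map_image_subset_topspace by blast
      \<comment> \<open>Both ways around the square send \<open>x\<close> to the coded evaluation at
        \<open>mor h x\<close>.\<close>
      have "S_map (CO (tgt h)) (CO (src h)) (CO_map (src h) (tgt h) (mor h)) (point_map (src h) x) =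
          code_point (CO (tgt h)) (hat (tgt h) (mor h x))"
        using x T.S_map_code_point[OF dom.hat_in_pts[OF x]] by (simp add: point_map_def compose_hat_CO_map)
      then show "compose (topspace (src h)) (point_map (tgt h)) (mor h) x =
        compose (topspace (src h)) (S_map (CO (tgt h)) (CO (src h)) (CO_map (src h) (tgt h) (mor h))) (point_map (src h)) x"
        using x y by (simp add: compose_eq) (simp add: point_map_def)
    qed simp_all
    with h Th show ?thesis
      by simp
  qed
  have "covariant (id_functor (Src ?T))" "covariant (?S \<circ>\<^sub>F ?T)"
    by (simp_all add: covariant_id_functor is_category_Stone covariant_comp_contravariant contravariant_S contravariant_T)
  then show "naturally_isomorphic (id_functor Stone) (?S \<circ>\<^sub>F ?T)"
    unfolding naturally_isomorphic_def
    using iso nat CO by (auto simp: Ar_Stone intro!: exI[of _ ?\<eta>])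
qed

text \<open>The unit from \<open>A\<close> to the clopen algebra of its Stone space: the coded form
  of sending \<open>a\<close> to its basic clopen set.\<close>

definition clopen_map :: "'u::set_universe boolalg \<Rightarrow> 'u \<Rightarrow> 'u" where
  "clopen_map A = (\<lambda>a\<in>carrier A. code {p \<in> topspace (S_ob A). a \<in> elts p})"

context small_boolean_algebra
begin

interpretation S: small_space "S_ob A"
  by (rule small_space_S_ob)

lemma elts_clopen_map: "a \<in> carrier A \<Longrightarrow> elts (clopen_map A a) = {p \<in> topspace (S_ob A). a \<in> elts p}"
  by (simp add: clopen_map_def S.elts_code_clopen)

lemma mem_elts_code_point: "\<lbrakk>x \<in> pts A; a \<in> carrier A\<rbrakk> \<Longrightarrow> a \<in> elts (code_point A x) \<longleftrightarrow> x a"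
  by (simp add: elts_code_point small_carrier)

text \<open>Injectivity says that points separate elements of \<open>A\<close>; surjectivity says
  that every clopen set is basic, which is where compactness enters.\<close>

lemma bij_clopen_map: "bij_betw (clopen_map A) (carrier A) (carrier (CO (S_ob A)))"
  unfolding bij_betw_def
proof
  show "inj_on (clopen_map A) (carrier A)"
  proof (rule inj_onI)
    fix a b assume ab: "a \<in> carrier A" "b \<in> carrier A" "clopen_map A a = clopen_map A b"
    then have eq: "{p \<in> topspace (S_ob A). a \<in> elts p} = {p \<in> topspace (S_ob A). b \<in> elts p}"
      by (metis elts_clopen_map)
    have "x a \<longleftrightarrow> x b" if "x \<in> pts A" for x
      using eq ab that mem_elts_code_point[OF that] by (auto simp: topspace_S_ob)
    then have "basic A a = basic A b"
      by (auto simp: basic_def)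
    with ab show "a = b"
      by (simp add: basic_inject)
  qed
  show "clopen_map A ` carrier A = carrier (CO (S_ob A))"
  proof
    show "clopen_map A ` carrier A \<subseteq> carrier (CO (S_ob A))"
      using clopen_S_ob_iff by (auto simp: S.carrier_CO elts_clopen_map)
    show "carrier (CO (S_ob A)) \<subseteq> clopen_map A ` carrier A"
    proof
      fix u assume "u \<in> carrier (CO (S_ob A))"
      then obtain a where a: "a \<in> carrier A" "elts u = {p \<in> topspace (S_ob A). a \<in> elts p}"
        unfolding S.carrier_CO clopen_S_ob_iff by blast
      then have "u = clopen_map A a"
        by (intro elts_inject) (simp add: elts_clopen_map)
      with a(1) show "u \<in> clopen_map A ` carrier A"
        by simp
    qed
  qed
qed

text \<open>A coded point is an ultrafilter. Read pointwise, these clauses are the homomorphism laws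
  of \<open>clopen_map\<close>.\<close>

lemma mem_elts_S_ob:
  assumes "p \<in> topspace (S_ob A)"
  shows "\<lbrakk>a \<in> carrier A; b \<in> carrier A\<rbrakk> \<Longrightarrow> meet A a b \<in> elts p \<longleftrightarrow> a \<in> elts p \<and> b \<in> elts p"
    and "\<lbrakk>a \<in> carrier A; b \<in> carrier A\<rbrakk> \<Longrightarrow> join A a b \<in> elts p \<longleftrightarrow> a \<in> elts p \<or> b \<in> elts p"
    and "a \<in> carrier A \<Longrightarrow> compl A a \<in> elts p \<longleftrightarrow> a \<notin> elts p"
    and "zero A \<notin> elts p" "one A \<in> elts p"
proof -
  obtain x where x: "x \<in> pts A" "p = code_point A x"
    using assms by (auto simp: topspace_S_ob)
  note mem = mem_elts_code_point[OF x(1), folded x(2)] and x = x(1)[unfolded pts_iff]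
  show "\<lbrakk>a \<in> carrier A; b \<in> carrier A\<rbrakk> \<Longrightarrow> meet A a b \<in> elts p \<longleftrightarrow> a \<in> elts p \<and> b \<in> elts p"
    "\<lbrakk>a \<in> carrier A; b \<in> carrier A\<rbrakk> \<Longrightarrow> join A a b \<in> elts p \<longleftrightarrow> a \<in> elts p \<or> b \<in> elts p"
    "a \<in> carrier A \<Longrightarrow> compl A a \<in> elts p \<longleftrightarrow> a \<notin> elts p"
    "zero A \<notin> elts p" "one A \<in> elts p"
    using x by (simp_all add: mem closed)
qed

lemma clopen_map_hom: "boolean_hom A (CO (S_ob A)) (clopen_map A)"
proof -
  have "clopen_map A a \<in> carrier (CO (S_ob A))" if "a \<in> carrier A" for a
    using bij_clopen_map that by (auto simp: bij_betw_def)
  moreover have "clopen_map A \<in> extensional (carrier A)"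
    by (simp add: clopen_map_def)
  ultimately have "clopen_map A \<in> boolean_homs A (CO (S_ob A))"
    unfolding boolean_homs_def PiE_def
    by (auto intro!: elts_inject simp: elts_clopen_map S.elts_CO S.CO_closed mem_elts_S_ob
        closed)
  then show ?thesis
    using small_boolean_algebra_axioms S.small_boolean_algebra_CO
    by (simp add: boolean_hom_def boolean_hom_axioms_def)
qed

end

lemma TS_iso_id:
  "naturally_isomorphic (T_functor \<circ>\<^sub>F S_functor) (id_functor (Boole :: ('u::set_universe boolalg, 'u boolarr) category))"
proof (rule naturally_isomorphic_sym)
  let ?S = "S_functor :: ('u boolalg, 'u boolarr, 'u topology, 'u toparr) functor_data"
  let ?T = "T_functor :: ('u topology, 'u toparr, 'u boolalg, 'u boolarr) functor_data"
  let ?\<eta> = "\<lambda>A :: 'u boolalg. Arrow A (CO (S_ob A)) (clopen_map A)"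
  have S: "Stone_space (S_ob A)" if "small_boolean_algebra A" for A :: "'u boolalg"
    using that by (rule small_boolean_algebra.Stone_space_S_ob)
  have iso: "isomorphism Boole (?\<eta> A)" if "small_boolean_algebra A" for A
    using that by (intro isomorphism_Boole small_boolean_algebra.clopen_map_hom small_boolean_algebra.bij_clopen_map)
  have nat: "Cmp Boole (?\<eta> (tgt h)) h = Cmp Boole (far ?T (far ?S h)) (?\<eta> (src h))"
    if h: "h \<in> Ar Boole" for h :: "'u boolarr"
  proof -
    interpret boolean_hom "src h" "tgt h" "mor h"
      using h by (simp add: Ar_Boole)
    have Sh: "far ?S h \<in> Ar Stone"
      using contravariantD(4)[OF contravariant_S, of h] h by simp
    then interpret S: continuous_small "S_ob (tgt h)" "S_ob (src h)" "S_map (src h) (tgt h) (mor h)"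
      using h Ar_StoneD[OF Sh] by simp
    interpret c: boolean_hom "src h" "CO (S_ob (src h))" "clopen_map (src h)"
      by (rule dom.clopen_map_hom)
    \<comment> \<open>Both sides have as extension the points \<open>p\<close> with
      \<open>mor h a\<close> in \<open>elts p\<close>.\<close>
    have "clopen_map (tgt h) (mor h a) =
        CO_map (S_ob (tgt h)) (S_ob (src h)) (S_map (src h) (tgt h) (mor h)) (clopen_map (src h) a)"
      if a: "a \<in> carrier (src h)" for a
      using a boolean_homsD(2)[OF hom a] boolean_homsD(2)[OF c.hom a] S_map_closed
      by (intro elts_inject) (auto simp: cod.elts_clopen_map dom.elts_clopen_map S.elts_CO_map elts_S_map)
    then have "compose (carrier (src h)) (clopen_map (tgt h)) (mor h) =
      compose (carrier (src h)) (CO_map (S_ob (tgt h)) (S_ob (src h)) (S_map (src h) (tgt h) (mor h))) (clopen_map (src h))"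
      by (auto simp: compose_def)
    with h Sh show ?thesis
      by simp
  qed
  have "covariant (id_functor (Src ?S))" "covariant (?T \<circ>\<^sub>F ?S)"
    by (simp_all add: covariant_id_functor is_category_Boole covariant_comp_contravariant contravariant_S contravariant_T)
  then show "naturally_isomorphic (id_functor Boole) (?T \<circ>\<^sub>F ?S)"
    unfolding naturally_isomorphic_def
    using iso nat S by (auto simp: Ar_Boole boolean_hom_def intro!: exI[of _ ?\<eta>])
qed

lemma dual_equivalences_T_S: "dual_equivalences T_functor S_functor"
  unfolding dual_equivalences_def
  by (simp add: contravariant_T contravariant_S ST_iso_id TS_iso_id)

section \<open>Restricting the functors between spaces and dz-algebras\<close>

text \<open>On objects this is \<open>hats_eq_pts\<close>, on arrows
  \<open>hat_map_eq_precomp\<close>. Since \<open>F_functor\<close> is itself restricted to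
  \<open>ZHaus\<close>, evaluating it also takes the inclusion of \<open>Stone\<close> in
  \<open>ZHaus\<close>.\<close>

lemma Fs_eq: "Fs_functor = E_functor \<circ>\<^sub>F (T_functor :: ('u::set_universe topology, 'u toparr, 'u boolalg, 'u boolarr) functor_data)"
  unfolding Fs_functor_def restrict_functor_def comp_functor_def F_functor_def
proof (rule mk_functor_cong)
  fix X :: "'u topology" assume "X \<in> Ob (Src T_functor)"
  then have X: "Stone_space X" and Z: "X \<in> Ob ZHaus"
    using Stone_subset_ZHaus by auto
  interpret small_space X
    using X by (simp add: Stone_space_def)
  show "fob (mk_functor ZHaus dzBoole F_ob (\<lambda>h. Arrow (F_ob (tgt h)) (F_ob (src h))
      (CO_map (src h) (tgt h) (mor h), hat_map (src h) (tgt h) (mor h)))) X = (fob E_functor \<circ> fob T_functor) X"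
    using X Z hats_eq_pts small_boolean_algebra_CO by (simp add: F_ob_def Stone_space_def[of X])
next
  fix h :: "'u toparr" assume "h \<in> Ar (Src T_functor)"
  then have h: "h \<in> Ar Stone" and Z: "h \<in> Ar ZHaus"
    using Stone_subset_ZHaus by auto
  interpret continuous_small "src h" "tgt h" "mor h"
    using h by (rule Ar_StoneD)
  have "far T_functor h \<in> Ar Boole"
    using contravariantD(4)[OF contravariant_T, of h] h by simp
  then show "far (mk_functor ZHaus dzBoole F_ob (\<lambda>h. Arrow (F_ob (tgt h)) (F_ob (src h))
      (CO_map (src h) (tgt h) (mor h), hat_map (src h) (tgt h) (mor h)))) h = (far E_functor \<circ> far T_functor) h"
    using h Z by (simp add: F_ob_def dom.hats_eq_pts cod.hats_eq_pts hat_map_eq_precomp Ar_Stone Stone_space_def)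
qed simp_all

lemma G_ob_pts:
  assumes "boolean_algebra_on A"
  shows "G_ob (A, pts A) = S_ob A"
proof -
  have "subtopology (stone_topology A) (pts A) = stone_topology A"
    using boolean_algebra_on.topspace_stone_topology[OF assms] by (metis subtopology_topspace)
  then show ?thesis
    by (simp add: G_ob_def S_ob_def)
qed

text \<open>The subspace of all points is the whole Stone space, and by \<open>Ar_kBoole\<close> the
  second component of an arrow is \<open>precomp\<close>, so its coded form is
  \<open>S_map\<close>.\<close>

lemma Gs_eq: "Gs_functor = S_functor \<circ>\<^sub>F (Einv_functor :: ('u::set_universe zalg, 'u zarr, 'u boolalg, 'u boolarr) functor_data)"
  unfolding Gs_functor_def restrict_functor_def comp_functor_def G_functor_def
proof (rule mk_functor_cong)
  fix P :: "'u zalg" assume "P \<in> Ob (Src Einv_functor)"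
  then have P: "P \<in> Ob kBoole"
    by simp
  then obtain A where A: "small_boolean_algebra A" "P = (A, pts A)"
    unfolding Ob_kBoole by blast
  then have "P \<in> Ob dzBoole"
    using kBoole_subset by auto
  with A P show "fob (mk_functor dzBoole ZHaus G_ob (\<lambda>h. Arrow (G_ob (tgt h)) (G_ob (src h))
      (\<lambda>p\<in>topspace (G_ob (tgt h)). code_point (fst (src h)) (snd (mor h) (decode (fst (tgt h)) p))))) P =
      (fob S_functor \<circ> fob Einv_functor) P"
    by (simp add: G_ob_pts small_boolean_algebra_def)
next
  fix h :: "'u zarr" assume "h \<in> Ar (Src Einv_functor)"
  then have h: "h \<in> Ar kBoole" by simp
  then obtain A B \<phi> where hom: "boolean_hom A B \<phi>" and hd: "h = Arrow (A, pts A) (B, pts B) (\<phi>, precomp A B \<phi>)"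
    by (auto simp: Ar_kBoole)
  have "h \<in> Ar dzBoole"
    using h by (simp add: kBoole_def)
  moreover have "Arrow A B \<phi> \<in> Ar Boole"
    using hom by (simp add: Ar_Boole)
  moreover have "boolean_algebra_on A" "boolean_algebra_on B"
    using hom by (simp_all add: boolean_hom_def small_boolean_algebra_def)
  ultimately show "far (mk_functor dzBoole ZHaus G_ob (\<lambda>h. Arrow (G_ob (tgt h)) (G_ob (src h))
      (\<lambda>p\<in>topspace (G_ob (tgt h)). code_point (fst (src h)) (snd (mor h) (decode (fst (tgt h)) p))))) h =
      (far S_functor \<circ> far Einv_functor) h"
    using h by (simp add: hd G_ob_pts S_map_def)
qed simp_all

lemma dual_equivalences_Fs_Gs: "dual_equivalences Fs_functor Gs_functor"
  unfolding Fs_eq Gs_eq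
  by (rule dual_equivalences_transport[OF dual_equivalences_T_S covariant_E _ covariant_Einv])
    (simp_all add: Einv_E E_Einv)

lemma contravariant_Fs: "contravariant Fs_functor" and contravariant_Gs: "contravariant Gs_functor"
  using dual_equivalences_Fs_Gs unfolding dual_equivalences_def by blast+

lemma Es_comp_Gs: "Es_functor \<circ>\<^sub>F Gs_functor = G_functor \<circ>\<^sub>F Ea_functor"
  using contravariant_Gs unfolding Es_functor_def Ea_functor_def Gs_functor_def
  by (subst comp_inclusion_eq_inclusion_comp) (simp_all add: G_functor_def)

lemma F_comp_Es: "F_functor \<circ>\<^sub>F Es_functor = Ea_functor \<circ>\<^sub>F Fs_functor"
  using contravariant_Fs unfolding Es_functor_def Ea_functor_def Fs_functor_def
  by (subst comp_inclusion_eq_inclusion_comp) (simp_all add: F_functor_def)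

lemma T_eq_Einv_Fs: "T_functor = Einv_functor \<circ>\<^sub>F Fs_functor"
proof -
  have "Einv_functor \<circ>\<^sub>F Fs_functor = (Einv_functor \<circ>\<^sub>F E_functor) \<circ>\<^sub>F T_functor"
    unfolding Fs_eq by (rule comp_functor_assoc[symmetric]) (simp_all add: contravariant_T)
  also have "\<dots> = T_functor"
    unfolding Einv_E T_functor_eq by (rule id_functor_comp_mk_functor[OF contravariant_T[unfolded T_functor_eq]])
  finally show ?thesis ..
qed

lemma S_eq_Gs_E: "S_functor = Gs_functor \<circ>\<^sub>F E_functor"
proof -
  have "Gs_functor \<circ>\<^sub>F E_functor = S_functor \<circ>\<^sub>F Einv_functor \<circ>\<^sub>F E_functor"
    unfolding Gs_eq by (rule comp_functor_assoc) (simp_all add: covariant_E)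
  also have "\<dots> = S_functor"
    unfolding Einv_E S_functor_eq by (rule mk_functor_comp_id_functor)
  finally show ?thesis ..
qed

lemma Es_comp_S: "Es_functor \<circ>\<^sub>F S_functor = G_functor \<circ>\<^sub>F Ea_functor \<circ>\<^sub>F E_functor"
proof -
  have "Es_functor \<circ>\<^sub>F S_functor = (Es_functor \<circ>\<^sub>F Gs_functor) \<circ>\<^sub>F E_functor"
    unfolding S_eq_Gs_E
    by (rule comp_functor_assoc[symmetric]) (simp_all add: covariant_E Gs_functor_def restrict_functor_def)
  also have "\<dots> = G_functor \<circ>\<^sub>F Ea_functor \<circ>\<^sub>F E_functor"
    unfolding Es_comp_Gs by (rule comp_functor_assoc) (simp_all add: covariant_E Ea_functor_def inclusion_functor_def)
  finally show ?thesis .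
qed

theorem proposition5p2:
  shows "(\<forall>X\<in>Ob (Stone :: ('u::set_universe topology, 'u toparr) category).
             fob F_functor (fob Es_functor X) \<in> Ob kBoole)
    \<and> (\<forall>P\<in>Ob (kBoole :: ('u zalg, 'u zarr) category).
             fob G_functor (fob Ea_functor P) \<in> Ob Stone)
    \<and> dual_equivalences
          (Fs_functor :: ('u topology, 'u toparr, 'u zalg, 'u zarr) functor_data)
          (Gs_functor :: ('u zalg, 'u zarr, 'u topology, 'u toparr) functor_data)
    \<and> (T_functor :: ('u topology, 'u toparr, 'u boolalg, 'u boolarr) functor_data)
          = Einv_functor \<circ>\<^sub>F Fs_functor
    \<and> (S_functor :: ('u boolalg, 'u boolarr, 'u topology, 'u toparr) functor_data)
          = Gs_functor \<circ>\<^sub>F E_functor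
    \<and> dual_equivalences
          (T_functor :: ('u topology, 'u toparr, 'u boolalg, 'u boolarr) functor_data)
          (S_functor :: ('u boolalg, 'u boolarr, 'u topology, 'u toparr) functor_data)
    \<and> (F_functor :: ('u topology, 'u toparr, 'u zalg, 'u zarr) functor_data) \<circ>\<^sub>F Es_functor
          = Ea_functor \<circ>\<^sub>F E_functor \<circ>\<^sub>F T_functor
    \<and> Es_functor \<circ>\<^sub>F (S_functor :: ('u boolalg, 'u boolarr, 'u topology, 'u toparr) functor_data)
          = G_functor \<circ>\<^sub>F Ea_functor \<circ>\<^sub>F E_functor"
proof (intro conjI ballI)
  \<comment> \<open>That the values lie in the smaller category is part of the contravariance of the
    restricted functor, on whose source the inclusion acts as the identity.\<close>
  show "fob F_functor (fob Es_functor X) \<in> Ob kBoole" if "X \<in> Ob Stone" for X :: "'u topology"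
    using contravariantD(3)[OF contravariant_Fs, of X] that
    by (simp add: Fs_functor_def restrict_functor_def Es_functor_def inclusion_functor_def)
  show "fob G_functor (fob Ea_functor P) \<in> Ob Stone" if "P \<in> Ob kBoole" for P :: "'u zalg"
    using contravariantD(3)[OF contravariant_Gs, of P] that
    by (simp add: Gs_functor_def restrict_functor_def Ea_functor_def inclusion_functor_def)
qed (rule dual_equivalences_Fs_Gs T_eq_Einv_Fs S_eq_Gs_E dual_equivalences_T_S
    F_comp_Es[unfolded Fs_eq] Es_comp_S)+

end
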